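(* Let $\mathbb F$ be a complete geodesic metric space and let $\mathcal P$ be a collection of closed geodesic subsets of $\mathbb F$ (pieces) such that $(T_1)$ every two different pieces have at most one common point. Then the following three conditions are equivalent: $(T_2)$ every simple geodesic triangle in $\mathbb F$ is contained in one piece; (b) the pieces cover $\mathbb F$, and $(T_2')$ holds: for every topological arc $\mathfrak c:[0,d]\to\mathbb F$ and $t\in[0,d]$, if $\mathfrak c[t-a,t+b]$ is a maximal sub-arc of $\mathfrak c$ containing $\mathfrak c(t)$ and contained in one piece, then every other topological arc with the same endpoints as $\mathfrak c$ contains the points $\mathfrak c(t-a)$ and $\mathfrak c(t+b)$; (c) the pieces cover $\mathbb F$, and $(T_2'')$ holds: every simple loop in $\mathbb F$ is contained in one piece. Thus condition $(T_2)$ in the definition of a tree-graded space can be replaced by the assumption that pieces cover $\mathbb F$ plus either one of $(T_2')$, $(T_2'')$.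
   Context: A subset $A$ of a geodesic metric space is geodesic if every two points of $A$ can be connected by a geodesic contained in $A$. A simple geodesic triangle is a simple loop composed of three geodesics; a point is regarded as a (degenerate) geodesic triangle composed of geodesics of length $0$, so $(T_2)$ implies that the pieces cover $\mathbb F$. A complete geodesic metric space $\mathbb F$, equipped with a collection $\mathcal P$ of closed geodesic subsets (called pieces), is tree-graded with respect to $\mathcal P$ if $(T_1)$ (every two different pieces have at most one common point) and $(T_2)$ (every simple geodesic triangle in $\mathbb F$ is contained in one piece) hold. Sub-arcs may be degenerate (points; $a,b\ge0$). *)

theory Defs
  imports "HOL-Analysis.Analysis"
begin

definition geodesic_segment_between :: "'a::metric_space set \<Rightarrow> 'a \<Rightarrow> 'a \<Rightarrow> bool" where
  "geodesic_segment_between S x y \<longleftrightarrow>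
     (\<exists>l \<gamma>. 0 \<le> l \<and> (\<forall>s\<in>{0..l}. \<forall>t\<in>{0..l}. dist (\<gamma> s) (\<gamma> t) = \<bar>s - t\<bar>) \<and>
        \<gamma> 0 = x \<and> \<gamma> l = y \<and> S = \<gamma> ` {0..l})"

definition geodesic_subset :: "'a::metric_space set \<Rightarrow> bool" where
  "geodesic_subset A \<longleftrightarrow>
     (\<forall>x\<in>A. \<forall>y\<in>A. \<exists>S. geodesic_segment_between S x y \<and> S \<subseteq> A)"

definition simple_loop :: "(real \<Rightarrow> 'a::topological_space) \<Rightarrow> bool" where
  "simple_loop g \<longleftrightarrow> simple_path g \<and> pathfinish g = pathstart g"

text \<open>The vertices are \<open>g 0\<close>, \<open>g u\<close> and \<open>g v\<close>. Sides of length 0 are allowed, so geodesic bigons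
  are included. A constant path is not a \<^const>\<open>simple_path\<close>; hence the separate disjunct for the
  degenerate triangle whose three sides all have length 0.\<close>

definition simple_geodesic_triangle :: "'a::metric_space set \<Rightarrow> bool" where
  "simple_geodesic_triangle T \<longleftrightarrow>
     (\<exists>x. T = {x}) \<or>
     (\<exists>g u v. simple_loop g \<and> T = path_image g \<and> 0 \<le> u \<and> u \<le> v \<and> v \<le> 1 \<and>
        geodesic_segment_between (g ` {0..u}) (g 0) (g u) \<and>
        geodesic_segment_between (g ` {u..v}) (g u) (g v) \<and>
        geodesic_segment_between (g ` {v..1}) (g v) (g 1))"

definition in_one_piece :: "'a set set \<Rightarrow> 'a set \<Rightarrow> bool" where
  "in_one_piece \<P> S \<longleftrightarrow> (\<exists>P\<in>\<P>. S \<subseteq> P)"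

definition cond_T1 :: "'a set set \<Rightarrow> bool" where
  "cond_T1 \<P> \<longleftrightarrow> (\<forall>P\<in>\<P>. \<forall>Q\<in>\<P>. P \<noteq> Q \<longrightarrow> (\<forall>x\<in>P \<inter> Q. \<forall>y\<in>P \<inter> Q. x = y))"

definition cond_T2 :: "'a::metric_space set set \<Rightarrow> bool" where
  "cond_T2 \<P> \<longleftrightarrow> (\<forall>T. simple_geodesic_triangle T \<longrightarrow> in_one_piece \<P> T)"

text \<open>Here \<open>s = t - a\<close> and \<open>u = t + b\<close> with \<open>a, b \<ge> 0\<close>. Maximality is among the sub-arcs that lie
  in some piece, and that piece may change with the sub-arc: a piece meeting the arc only in
  \<open>c t\<close> does not make the degenerate sub-arc \<open>{c t}\<close> maximal.\<close>

definition maximal_subarc_in_piece ::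
    "'a set set \<Rightarrow> (real \<Rightarrow> 'a) \<Rightarrow> real \<Rightarrow> real \<Rightarrow> real \<Rightarrow> bool" where
  "maximal_subarc_in_piece \<P> c t s u \<longleftrightarrow>
     0 \<le> s \<and> s \<le> t \<and> t \<le> u \<and> u \<le> 1 \<and> in_one_piece \<P> (c ` {s..u}) \<and>
     (\<forall>s' u'. 0 \<le> s' \<and> s' \<le> s \<and> u \<le> u' \<and> u' \<le> 1 \<and> in_one_piece \<P> (c ` {s'..u'}) \<longrightarrow>
        s' = s \<and> u' = u)"

text \<open>Topological arcs are normalised to the parameter interval \<open>[0,1]\<close>, as in \<^const>\<open>arc\<close>. For
  \<open>c'\<close> with the same image as \<open>c\<close> the conclusion is trivial, so \<open>c'\<close> is not required to differ
  from \<open>c\<close>.\<close>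

definition cond_T2' :: "'a::topological_space set set \<Rightarrow> bool" where
  "cond_T2' \<P> \<longleftrightarrow>
     (\<forall>c t s u. arc c \<and> t \<in> {0..1} \<and> maximal_subarc_in_piece \<P> c t s u \<longrightarrow>
        (\<forall>c'. arc c' \<and> pathstart c' = pathstart c \<and> pathfinish c' = pathfinish c \<longrightarrow>
           c s \<in> path_image c' \<and> c u \<in> path_image c'))"

definition cond_T2'' :: "'a::topological_space set set \<Rightarrow> bool" where
  "cond_T2'' \<P> \<longleftrightarrow> (\<forall>g. simple_loop g \<longrightarrow> in_one_piece \<P> (path_image g))"

definition tree_graded :: "'a::complete_space set set \<Rightarrow> bool" where
  "tree_graded \<P> \<longleftrightarrow>
     geodesic_subset (UNIV :: 'a set) \<and> (\<forall>P\<in>\<P>. closed P \<and> geodesic_subset P) \<and>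
     cond_T1 \<P> \<and> cond_T2 \<P>"

end

theory Submission
  imports Defs
begin

text \<open>The main implication is from \<open>(T\<^sub>2)\<close> to \<open>(T\<^sub>2'')\<close>. By \<open>geodesic_side_in_piece\<close>, a side of a geodesic triangle is,
  wherever it leaves the other two sides, contained in pieces. This first gives each point \<open>x\<close> a gate in each
  piece \<open>M\<close>, a point of \<open>M\<close> through which shortest ways from \<open>x\<close> to all points of \<open>M\<close> lead (\<open>gate_exists\<close>),
  and shows that the gate does not change as \<open>x\<close> moves in a connected set off \<open>M\<close>
  (\<open>gate_eq_on_connected\<close>). A path from \<open>x\<close> into \<open>M\<close> must therefore enter \<open>M\<close> at the gate of \<open>x\<close>. In
  particular an arc cannot leave \<open>M\<close> and come back, since it would have to use the same gate twice; so an arc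
  with endpoints in \<open>M\<close> stays in \<open>M\<close>, and a simple loop which meets a piece in two points is contained in it.

  It remains to find a piece which meets a given simple loop twice. Split the loop into two arcs and join
  their common endpoints by a geodesic \<open>h\<close>. At least one of the arcs, say \<open>c\<close>, misses the midpoint of \<open>h\<close>. But
  an interior point \<open>z\<close> of \<open>h\<close> separates the ends of \<open>h\<close>, unless some piece contains \<open>z\<close> and another point of \<open>h\<close>
  (\<open>geodesic_cut_point\<close>). So there is such a piece; the ends of \<open>h\<close> have different gates in it, and \<open>c\<close>
  passes through both.

  The equivalence of \<open>(T\<^sub>2')\<close> and \<open>(T\<^sub>2'')\<close> for covering pieces rests on (T1). If an arc avoids an end of a
  maximal sub-arc of \<open>c\<close>, it cuts off a simple loop containing a stretch of \<open>c\<close> around that end, and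
  the piece of this loop extends the sub-arc. Conversely, for the two arcs that make up a simple loop,
  \<open>(T\<^sub>2')\<close> leaves no possible ends for a maximal sub-arc of one of them but its own endpoints. From
  \<open>(T\<^sub>2'')\<close> back to \<open>(T\<^sub>2)\<close> only degenerate triangles are not simple loops, and these are points, which are
  covered.\<close>

section \<open>Sub-arcs, first hitting times and loops\<close>

text \<open>For \<open>b < a\<close> the sub-arc is run through backwards; this saves reversing paths when loops are
  assembled from sub-arcs of either direction.\<close>
definition subarc :: "real \<Rightarrow> real \<Rightarrow> (real \<Rightarrow> 'a) \<Rightarrow> real \<Rightarrow> 'a" where
  "subarc a b g = (\<lambda>t. g (a + (b - a) * t))"

lemma subarc_0 [simp]: "subarc a b g 0 = g a"
  and subarc_1 [simp]: "subarc a b g 1 = g b"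
  by (simp_all add: subarc_def)

lemma pathstart_subarc [simp]: "pathstart (subarc a b g) = g a"
  and pathfinish_subarc [simp]: "pathfinish (subarc a b g) = g b"
  by (simp_all add: pathstart_def pathfinish_def)

lemma affine_param_image: "(\<lambda>t. a + (b - a) * t) ` {0..1} = closed_segment a (b::real)"
  by (force simp: closed_segment_def algebra_simps)

lemma affine_param_in_unit:
  assumes "a \<in> {0..1}" "b \<in> {0..1}" "t \<in> {0..1}"
  shows "a + (b - a) * t \<in> {0..1::real}"
proof -
  have "a + (b - a) * t \<in> closed_segment a b"
    using assms(3) affine_param_image by blast
  moreover have "closed_segment a b \<subseteq> {0..1}"
    using assms(1,2) by (auto simp: closed_segment_eq_real_ivl split: if_splits)
  ultimately show ?thesis by blast
qed

lemma path_image_subarc: "path_image (subarc a b g) = g ` closed_segment a b"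
  unfolding path_image_def subarc_def affine_param_image[symmetric] image_image ..

lemma path_image_subarc_le: "a \<le> b \<Longrightarrow> path_image (subarc a b g) = g ` {a..b}"
  by (simp add: path_image_subarc closed_segment_eq_real_ivl)

lemma path_image_subarc_subset:
  assumes "a \<in> {0..1}" "b \<in> {0..1}"
  shows "path_image (subarc a b g) \<subseteq> path_image g"
  using affine_param_in_unit[OF assms] by (auto simp: path_image_def subarc_def)

lemma path_subarc:
  assumes "path g" "a \<in> {0..1}" "b \<in> {0..1}"
  shows "path (subarc a b g)"
proof -
  have "continuous_on {0..1} (\<lambda>t. a + (b - a) * t)" by (intro continuous_intros)
  moreover have "(\<lambda>t. a + (b - a) * t) ` {0..1} \<subseteq> {0..1}"
    using affine_param_in_unit[OF assms(2,3)] by blast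
  ultimately show ?thesis
    using assms(1) unfolding path_def subarc_def by (metis continuous_on_compose2)
qed

lemma arc_subarc:
  assumes "path g" "inj_on g (closed_segment a b)" "a \<in> {0..1}" "b \<in> {0..1}" "a \<noteq> b"
  shows "arc (subarc a b g)"
proof -
  have "inj_on (subarc a b g) {0..1}"
  proof (rule inj_onI)
    fix s t :: real assume st: "s \<in> {0..1}" "t \<in> {0..1}" "subarc a b g s = subarc a b g t"
    then have "a + (b - a) * s = a + (b - a) * t"
      using assms(2) affine_param_image unfolding subarc_def inj_on_def by blast
    with \<open>a \<noteq> b\<close> show "s = t" by simp
  qed
  then show ?thesis using path_subarc[OF assms(1,3,4)] by (simp add: arc_def)
qed

lemma arc_subarc_arc:
  assumes "arc g" "a \<in> {0..1}" "b \<in> {0..1}" "a \<noteq> b"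
  shows "arc (subarc a b g)"
proof (rule arc_subarc[OF _ _ assms(2-4)])
  show "path g" using assms(1) by (simp add: arc_def)
  have "inj_on g {0..1}" using assms(1) by (simp add: arc_def)
  moreover have "closed_segment a b \<subseteq> {0..1}"
    using assms(2,3) by (auto simp: closed_segment_eq_real_ivl split: if_splits)
  ultimately show "inj_on g (closed_segment a b)" by (rule inj_on_subset)
qed

lemma first_hit:
  fixes g :: "real \<Rightarrow> 'a::t2_space"
  assumes "continuous_on {a..b} g" "closed K" "a \<le> b" "g b \<in> K"
  obtains u where "a \<le> u" "u \<le> b" "g u \<in> K" "\<And>x. a \<le> x \<Longrightarrow> x < u \<Longrightarrow> g x \<notin> K"
proof -
  let ?S = "{a..b} \<inter> g -` K"
  have "closed ?S" by (rule continuous_closed_preimage[OF assms(1) closed_atLeastAtMost assms(2)])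
  then have "compact ?S" by (metis compact_Icc compact_Int_closed inf.left_idem)
  moreover have "?S \<noteq> {}" using assms by auto
  ultimately obtain u where "u \<in> ?S" "\<forall>x\<in>?S. u \<le> x" using compact_attains_inf by blast
  then have u: "a \<le> u" "u \<le> b" "g u \<in> K" and least: "\<And>x. a \<le> x \<Longrightarrow> x \<le> b \<Longrightarrow> g x \<in> K \<Longrightarrow> u \<le> x"
    by auto
  show thesis
  proof (rule that[OF u])
    show "g x \<notin> K" if "a \<le> x" "x < u" for x using least[of x] that u by auto
  qed
qed

lemma last_hit:
  fixes g :: "real \<Rightarrow> 'a::t2_space"
  assumes "continuous_on {a..b} g" "closed K" "a \<le> b" "g a \<in> K"
  obtains u where "a \<le> u" "u \<le> b" "g u \<in> K" "\<And>x. u < x \<Longrightarrow> x \<le> b \<Longrightarrow> g x \<notin> K"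
proof -
  let ?S = "{a..b} \<inter> g -` K"
  have "closed ?S" by (rule continuous_closed_preimage[OF assms(1) closed_atLeastAtMost assms(2)])
  then have "compact ?S" by (metis compact_Icc compact_Int_closed inf.left_idem)
  moreover have "?S \<noteq> {}" using assms by auto
  ultimately obtain u where "u \<in> ?S" "\<forall>x\<in>?S. x \<le> u" using compact_attains_sup by blast
  then have u: "a \<le> u" "u \<le> b" "g u \<in> K" and greatest: "\<And>x. a \<le> x \<Longrightarrow> x \<le> b \<Longrightarrow> g x \<in> K \<Longrightarrow> x \<le> u"
    by auto
  show thesis
  proof (rule that[OF u])
    show "g x \<notin> K" if "u < x" "x \<le> b" for x using greatest[of x] that u by auto
  qed
qed

text \<open>Move the base point of the loop to \<open>a\<close>; then \<open>b\<close> has an interior parameter, and cutting there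
  gives the two arcs.\<close>
lemma simple_loop_double_arc:
  fixes g :: "real \<Rightarrow> 'a::topological_space"
  assumes "simple_loop g" "a \<in> path_image g" "b \<in> path_image g" "a \<noteq> b"
  obtains c d where "arc c" "arc d" "pathstart c = a" "pathfinish c = b"
    "pathstart d = b" "pathfinish d = a"
    "path_image c \<inter> path_image d = {a, b}" "path_image c \<union> path_image d = path_image g"
proof -
  have g: "simple_path g" "pathfinish g = pathstart g" using assms(1) by (auto simp: simple_loop_def)
  obtain u where u: "0 \<le> u" "u \<le> 1" "g u = a" using assms(2) by (auto simp: path_image_def)
  define h where "h = shiftpath u g"
  have h: "simple_path h" "h 0 = a" "h 1 = a" "path_image h = path_image g"
    using g u simple_path_shiftpath[of g u] pathstart_shiftpath[of u g] pathfinish_shiftpath[of u g]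
      path_image_shiftpath[of u g]
    by (auto simp: h_def pathstart_def pathfinish_def)
  have "b \<in> h ` {0..1}" using assms(3) h(4) by (simp add: path_image_def)
  then obtain v where v: "v \<in> {0..1}" "h v = b" by (metis imageE)
  have v01: "0 < v" "v < 1" using v h(2,3) \<open>a \<noteq> b\<close> by (auto simp: less_le)
  have inj: "s = t \<or> s = 0 \<and> t = 1 \<or> s = 1 \<and> t = 0" if "h s = h t" "s \<in> {0..1}" "t \<in> {0..1}" for s t
    using h(1) that unfolding simple_path_def loop_free_def by blast
  have "path h" using h(1) by (simp add: simple_path_def)
  have "inj_on h {0..v}" "inj_on h {v..1}"
    using v01 by (auto intro!: inj_onI dest!: inj)
  then have arcs: "arc (subarc 0 v h)" "arc (subarc v 1 h)"
    using v01 \<open>path h\<close> by (auto intro!: arc_subarc simp: closed_segment_eq_real_ivl)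
  show thesis
  proof (rule that[OF arcs])
    show "path_image (subarc 0 v h) \<inter> path_image (subarc v 1 h) = {a, b}"
    proof
      show "path_image (subarc 0 v h) \<inter> path_image (subarc v 1 h) \<subseteq> {a, b}"
      proof
        fix x assume "x \<in> path_image (subarc 0 v h) \<inter> path_image (subarc v 1 h)"
        then obtain s t where st: "s \<in> {0..v}" "t \<in> {v..1}" "x = h s" "h s = h t"
          using v01 by (auto simp: path_image_subarc_le)
        then have "s = t \<or> s = 0" using inj[of s t] v01 by auto
        then have "s = v \<or> s = 0" using st by auto
        then show "x \<in> {a, b}" using st v h by auto
      qed
      show "{a, b} \<subseteq> path_image (subarc 0 v h) \<inter> path_image (subarc v 1 h)"
        using pathstart_in_path_image[of "subarc 0 v h"] pathfinish_in_path_image[of "subarc 0 v h"]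
          pathstart_in_path_image[of "subarc v 1 h"] pathfinish_in_path_image[of "subarc v 1 h"] v h
        by auto
    qed
    have "{0..1} = {0..v} \<union> {v..1}" using v01 by auto
    then have "path_image h = h ` {0..v} \<union> h ` {v..1}" by (simp add: path_image_def image_Un)
    then show "path_image (subarc 0 v h) \<union> path_image (subarc v 1 h) = path_image g"
      using v01 h(4) by (simp add: path_image_subarc_le)
  qed (use v h in auto)
qed

section \<open>Geodesics parametrised proportionally to arc length\<close>

text \<open>A geodesic with constant speed on \<open>[0,1]\<close>, so that it is a path in the usual parametrisation and
  its sub-arcs are again of this kind. Taking \<open>s = 0\<close> and \<open>t = 1\<close> shows that the speed can only be the
  distance of the endpoints; constant paths are included.\<close>
definition geodesic_path :: "(real \<Rightarrow> 'a::metric_space) \<Rightarrow> bool" where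
  "geodesic_path g \<longleftrightarrow>
     (\<forall>s\<in>{0..1}. \<forall>t\<in>{0..1}. dist (g s) (g t) = dist (g 0) (g 1) * \<bar>s - t\<bar>)"

lemma geodesic_pathD:
  "geodesic_path g \<Longrightarrow> s \<in> {0..1} \<Longrightarrow> t \<in> {0..1} \<Longrightarrow> dist (g s) (g t) = dist (g 0) (g 1) * \<bar>s - t\<bar>"
  unfolding geodesic_path_def by blast

lemma geodesic_path_imp_path:
  assumes "geodesic_path g"
  shows "path g"
proof -
  have "(dist (g 0) (g 1))-lipschitz_on {0..1} g"
  proof (rule lipschitz_onI)
    show "dist (g s) (g t) \<le> dist (g 0) (g 1) * dist s t" if "s \<in> {0..1}" "t \<in> {0..1}" for s t
      unfolding geodesic_pathD[OF assms that] dist_real_def by (rule order_refl)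
  qed (rule zero_le_dist)
  then show ?thesis unfolding path_def by (rule lipschitz_on_continuous_on)
qed

lemma geodesic_path_inj:
  assumes "geodesic_path g" "g 0 \<noteq> g 1" "s \<in> {0..1}" "t \<in> {0..1}"
  shows "g s = g t \<longleftrightarrow> s = t"
proof -
  have "dist (g s) (g t) = 0 \<longleftrightarrow> \<bar>s - t\<bar> = 0"
    unfolding geodesic_pathD[OF assms(1,3,4)] using assms(2) by (simp only: mult_eq_0_iff dist_eq_0_iff simp_thms)
  then show ?thesis by simp
qed

lemma geodesic_path_imp_arc:
  assumes "geodesic_path g" "g 0 \<noteq> g 1"
  shows "arc g"
  unfolding arc_def
proof
  show "path g" using assms(1) by (rule geodesic_path_imp_path)
  show "inj_on g {0..1}" using geodesic_path_inj[OF assms] by (intro inj_onI) blast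
qed

lemma closed_geodesic_image: "geodesic_path g \<Longrightarrow> closed (path_image g)"
  by (simp add: compact_imp_closed compact_path_image geodesic_path_imp_path)

lemma geodesic_path_subarc:
  assumes "geodesic_path g" "a \<in> {0..1}" "b \<in> {0..1}"
  shows "geodesic_path (subarc a b g)"
  unfolding geodesic_path_def
proof (intro ballI)
  fix s t :: real assume st: "s \<in> {0..1}" "t \<in> {0..1}"
  have "dist (subarc a b g s) (subarc a b g t)
      = dist (g 0) (g 1) * \<bar>(a + (b - a) * s) - (a + (b - a) * t)\<bar>"
    unfolding subarc_def
    by (rule geodesic_pathD[OF assms(1)]) (intro affine_param_in_unit assms(2,3) st)+
  also have "(a + (b - a) * s) - (a + (b - a) * t) = (b - a) * (s - t)"
    by (simp add: algebra_simps)
  also have "dist (g 0) (g 1) * \<bar>(b - a) * (s - t)\<bar> = dist (g 0) (g 1) * \<bar>a - b\<bar> * \<bar>s - t\<bar>"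
    by (simp add: abs_mult abs_minus_commute)
  also have "dist (g 0) (g 1) * \<bar>a - b\<bar> = dist (subarc a b g 0) (subarc a b g 1)"
    using geodesic_pathD[OF assms] by simp
  finally show "dist (subarc a b g s) (subarc a b g t)
      = dist (subarc a b g 0) (subarc a b g 1) * \<bar>s - t\<bar>" .
qed

lemma geodesic_path_dist_0:
  assumes "geodesic_path g" "t \<in> {0..1}"
  shows "dist (g 0) (g t) = dist (g 0) (g 1) * t"
proof -
  have "dist (g 0) (g t) = dist (g 0) (g 1) * \<bar>0 - t\<bar>"
    by (rule geodesic_pathD[OF assms(1)]) (use assms(2) in auto)
  then show ?thesis using assms(2) by simp
qed

lemma geodesic_path_dist_1:
  assumes "geodesic_path g" "t \<in> {0..1}"
  shows "dist (g t) (g 1) = dist (g 0) (g 1) * (1 - t)"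
proof -
  have "dist (g t) (g 1) = dist (g 0) (g 1) * \<bar>t - 1\<bar>"
    by (rule geodesic_pathD[OF assms(1)]) (use assms(2) in auto)
  also have "\<bar>t - 1\<bar> = 1 - t" using assms(2) by simp
  finally show ?thesis .
qed

lemma path_image_const_geodesic:
  assumes "geodesic_path g" "g 0 = g 1"
  shows "path_image g = {g 0}"
proof -
  have const: "g t = g 0" if "t \<in> {0..1}" for t
  proof -
    have "dist (g 0) (g t) = 0"
      using geodesic_path_dist_0[OF assms(1) that] by (simp add: assms(2))
    then show ?thesis by simp
  qed
  have "g ` {0..1} = (\<lambda>_::real. g 0) ` {0..1}" by (rule image_cong[OF refl], rule const)
  also have "\<dots> = {g 0}" by (simp add: image_constant_conv)
  finally show ?thesis unfolding path_image_def .
qed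

lemma geodesic_path_dist_sum:
  assumes "geodesic_path g" "z \<in> path_image g"
  shows "dist (g 0) z + dist z (g 1) = dist (g 0) (g 1)"
proof -
  obtain t where t: "t \<in> {0..1}" "z = g t" using assms(2) by (auto simp: path_image_def)
  show ?thesis
    unfolding t(2) geodesic_path_dist_0[OF assms(1) t(1)] geodesic_path_dist_1[OF assms(1) t(1)]
    by (simp add: algebra_simps)
qed

lemma geodesic_path_dist_le:
  assumes "geodesic_path g" "z \<in> path_image g"
  shows "dist (g 0) z \<le> dist (g 0) (g 1)"
  using geodesic_path_dist_sum[OF assms] zero_le_dist[of z "g 1"] by linarith

lemma geodesic_segment_between_path_image:
  assumes "geodesic_path g"
  shows "geodesic_segment_between (path_image g) (g 0) (g 1)"
proof (cases "g 0 = g 1")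
  case True
  then show ?thesis
    unfolding geodesic_segment_between_def path_image_const_geodesic[OF assms True]
    by (intro exI[of _ 0] exI[of _ "\<lambda>_. g 0"]) auto
next
  case False
  define l where "l = dist (g 0) (g 1)"
  have l: "l > 0" using False by (simp add: l_def)
  have "dist (g (s / l)) (g (t / l)) = \<bar>s - t\<bar>" if "s \<in> {0..l}" "t \<in> {0..l}" for s t
  proof -
    have "dist (g (s / l)) (g (t / l)) = l * \<bar>s / l - t / l\<bar>"
      unfolding l_def by (rule geodesic_pathD[OF assms]) (use that l in \<open>auto simp flip: l_def\<close>)
    also have "\<bar>s / l - t / l\<bar> = \<bar>s - t\<bar> / l" using l by (simp add: diff_divide_distrib[symmetric])
    finally show ?thesis using l by simp
  qed
  moreover have "path_image g = (\<lambda>s. g (s / l)) ` {0..l}"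
  proof -
    have "(\<lambda>s. s / l) ` {0..l} = {0..1}" using l by (simp add: image_divide_atLeastAtMost)
    then show ?thesis unfolding path_image_def by (metis image_image)
  qed
  ultimately show ?thesis
    unfolding geodesic_segment_between_def using l
    by (intro exI[of _ l] exI[of _ "\<lambda>s. g (s / l)"]) (auto simp: l_def)
qed

lemma geodesic_path_of_segment:
  assumes "geodesic_segment_between S x y"
  obtains g where "geodesic_path g" "g 0 = x" "g 1 = y" "path_image g = S"
proof -
  obtain l \<gamma> where l: "0 \<le> l" and iso: "\<And>s t. s \<in> {0..l} \<Longrightarrow> t \<in> {0..l} \<Longrightarrow> dist (\<gamma> s) (\<gamma> t) = \<bar>s - t\<bar>"
    and ends: "\<gamma> 0 = x" "\<gamma> l = y" and S: "S = \<gamma> ` {0..l}"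
    using assms unfolding geodesic_segment_between_def by blast
  have d: "dist (\<gamma> (l * s)) (\<gamma> (l * t)) = l * \<bar>s - t\<bar>" if "s \<in> {0..1}" "t \<in> {0..1}" for s t
  proof -
    have "dist (\<gamma> (l * s)) (\<gamma> (l * t)) = \<bar>l * s - l * t\<bar>"
      by (rule iso) (use that l in \<open>auto simp: mult_left_le\<close>)
    then show ?thesis using l by (simp add: abs_mult flip: right_diff_distrib)
  qed
  have "geodesic_path (\<lambda>t. \<gamma> (l * t))"
    unfolding geodesic_path_def using d[of 0 1] d by simp
  moreover have "path_image (\<lambda>t. \<gamma> (l * t)) = S"
  proof -
    have "(*) l ` {0..1} = {0..l}" using l by (simp add: image_mult_atLeastAtMost_if)
    then show ?thesis unfolding path_image_def S by (metis image_image)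
  qed
  ultimately show thesis using that ends by simp
qed

text \<open>Equality in the triangle inequality forces two consecutive geodesics to form one geodesic: a
  shortcut between a point of the first and a point of the second would shorten the whole way.\<close>
lemma geodesic_path_concat:
  assumes a: "geodesic_path a" and b: "geodesic_path b" and "a 1 = b 0"
    and sum: "dist (a 0) (b 1) = dist (a 0) (a 1) + dist (b 0) (b 1)"
  obtains c where "geodesic_path c" "c 0 = a 0" "c 1 = b 1" "path_image c = path_image a \<union> path_image b"
proof -
  define p q where "p = dist (a 0) (a 1)" and "q = dist (b 0) (b 1)"
  consider "p = 0" | "q = 0" | "p > 0" "q > 0" unfolding p_def q_def by fastforce
  then show thesis
  proof cases
    case 1
    then have "path_image a = {b 0}"
      using path_image_const_geodesic[OF a] \<open>a 1 = b 0\<close> by (simp add: p_def)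
    moreover have "b 0 \<in> path_image b" by (auto simp: path_image_def)
    ultimately show ?thesis using that[OF b] 1 \<open>a 1 = b 0\<close> by (auto simp: p_def)
  next
    case 2
    then have "path_image b = {a 1}"
      using path_image_const_geodesic[OF b] \<open>a 1 = b 0\<close> by (simp add: q_def)
    moreover have "a 1 \<in> path_image a" by (auto simp: path_image_def)
    ultimately show ?thesis using that[OF a] 2 \<open>a 1 = b 0\<close> by (auto simp: q_def)
  next
    case 3
    define L where "L = p + q"
    define \<gamma> where "\<gamma> s = (if s \<le> p then a (s / p) else b ((s - p) / q))" for s
    have L: "L > 0" "dist (a 0) (b 1) = L" using 3 sum unfolding L_def by (simp_all flip: p_def q_def)
    have \<gamma>b: "\<gamma> s = b ((s - p) / q)" if "s \<ge> p" for s
      using that 3 \<open>a 1 = b 0\<close> by (auto simp: \<gamma>_def)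
    have da: "dist (\<gamma> s) (\<gamma> t) = \<bar>s - t\<bar>" if "0 \<le> s" "s \<le> p" "0 \<le> t" "t \<le> p" for s t
    proof -
      have "dist (a (s / p)) (a (t / p)) = p * \<bar>s / p - t / p\<bar>"
        unfolding p_def by (rule geodesic_pathD[OF a]) (use that 3 in \<open>auto simp flip: p_def\<close>)
      also have "\<bar>s / p - t / p\<bar> = \<bar>s - t\<bar> / p" using 3 by (simp add: diff_divide_distrib[symmetric])
      finally show ?thesis using that 3 by (simp add: \<gamma>_def)
    qed
    have db: "dist (\<gamma> s) (\<gamma> t) = \<bar>s - t\<bar>" if "p \<le> s" "s \<le> L" "p \<le> t" "t \<le> L" for s t
    proof -
      have "dist (b ((s - p) / q)) (b ((t - p) / q)) = q * \<bar>(s - p) / q - (t - p) / q\<bar>"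
        unfolding q_def by (rule geodesic_pathD[OF b]) (use that 3 in \<open>auto simp: L_def simp flip: q_def\<close>)
      also have "\<bar>(s - p) / q - (t - p) / q\<bar> = \<bar>s - t\<bar> / q"
        using 3 by (simp add: diff_divide_distrib[symmetric])
      finally show ?thesis using that 3 by (simp add: \<gamma>b)
    qed
    have ends: "\<gamma> 0 = a 0" "\<gamma> L = b 1" using 3 by (auto simp: \<gamma>_def L_def)
    have dab: "dist (\<gamma> s) (\<gamma> t) = t - s" if "0 \<le> s" "s \<le> p" "p \<le> t" "t \<le> L" for s t
    proof (rule antisym)
      show "dist (\<gamma> s) (\<gamma> t) \<le> t - s"
        using dist_triangle[of "\<gamma> s" "\<gamma> t" "\<gamma> p"] da[of s p] db[of p t] that by simp
      show "t - s \<le> dist (\<gamma> s) (\<gamma> t)"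
        using dist_triangle[of "\<gamma> 0" "\<gamma> L" "\<gamma> s"] dist_triangle[of "\<gamma> s" "\<gamma> L" "\<gamma> t"]
          da[of 0 s] db[of t L] that L ends by simp
    qed
    have iso: "dist (\<gamma> s) (\<gamma> t) = \<bar>s - t\<bar>" if "s \<in> {0..L}" "t \<in> {0..L}" for s t
      using da[of s t] db[of s t] dab[of s t] dab[of t s] that
      by (cases "s \<le> p"; cases "t \<le> p") (auto simp: dist_commute)
    have "\<gamma> ` {0..p} = path_image a"
    proof -
      have "(\<lambda>s. s / p) ` {0..p} = {0..1}" 
        using 3 by (simp add: image_divide_atLeastAtMost)
      moreover have "\<gamma> ` {0..p} = a ` (\<lambda>s. s / p) ` {0..p}"
        unfolding image_image by (intro image_cong) (auto simp: \<gamma>_def)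
      ultimately show ?thesis by (simp add: path_image_def)
    qed
    moreover have "\<gamma> ` {p..L} = path_image b"
    proof -
      have "t = ((p + q * t) - p) / q \<and> p + q * t \<in> {p..L}" if "t \<in> {0..1}" for t
        using that 3 by (auto simp: L_def mult_left_le)
      then have "{0..1} \<subseteq> (\<lambda>s. (s - p) / q) ` {p..L}" by blast
      moreover have "(\<lambda>s. (s - p) / q) ` {p..L} \<subseteq> {0..1}"  using 3 by (auto simp: L_def)
      moreover have "\<gamma> ` {p..L} = b ` (\<lambda>s. (s - p) / q) ` {p..L}"
        unfolding image_image by (intro image_cong) (auto simp: \<gamma>b)
      ultimately show ?thesis unfolding path_image_def by (metis subset_antisym)
    qed
    moreover have "{0..L} = {0..p} \<union> {p..L}" using 3 by (auto simp: L_def)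
    ultimately have "geodesic_segment_between (path_image a \<union> path_image b) (a 0) (b 1)"
      unfolding geodesic_segment_between_def using L ends iso
      by (intro exI[of _ L] exI[of _ \<gamma>]) (auto simp: image_Un)
    then show ?thesis using geodesic_path_of_segment that by metis
  qed
qed

section \<open>Geodesic triangles and pieces\<close>

lemma joinpaths_image_left: "(g +++ h) ` {0..1/2} = path_image g"
proof -
  have "(g +++ h) ` {0..1/2} = g ` (*) 2 ` {0..1/2}"
    unfolding image_image by (intro image_cong) (auto simp: joinpaths_def)
  also have "(*) 2 ` {0..1/2} = {0..1::real}" by (simp add: image_mult_atLeastAtMost_if)
  finally show ?thesis by (simp add: path_image_def)
qed

lemma joinpaths_image_right:
  assumes "pathfinish g = pathstart h" "0 \<le> s"
  shows "(g +++ h) ` {(1 + s) / 2..(1 + t) / 2} = h ` {s..t}"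
proof -
  have "(g +++ h) ` {(1 + s) / 2..(1 + t) / 2} = h ` (\<lambda>x. 2 * x - 1) ` {(1 + s) / 2..(1 + t) / 2}"
    unfolding image_image
  proof (intro image_cong refl)
    fix x assume x: "x \<in> {(1 + s) / 2..(1 + t) / 2}"
    show "(g +++ h) x = h (2 * x - 1)"
    proof (cases "x \<le> 1 / 2")
      case True
      with x assms(2) have "x = 1 / 2" by (auto simp: field_simps)
      show ?thesis
        unfolding \<open>x = 1 / 2\<close> using assms(1) by (simp add: joinpaths_def pathstart_def pathfinish_def)
    qed (simp add: joinpaths_def)
  qed
  also have "(\<lambda>x. 2 * x - 1) ` {(1 + s) / 2..(1 + t) / 2} = {s..t}"
  proof -
    have "y \<in> (\<lambda>x. 2 * x - 1) ` {(1 + s) / 2..(1 + t) / 2}" if "y \<in> {s..t}" for y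
      using that by (intro image_eqI[of _ _ "(1 + y) / 2"]) (auto simp: field_simps)
    then show ?thesis by (auto simp: field_simps)
  qed
  finally show ?thesis .
qed

lemma joinpaths_image_right':
  assumes "pathfinish g = pathstart h"
  shows "(g +++ h) ` {1/2..1} = path_image h"
  using joinpaths_image_right[OF assms, of 0 1] by (simp add: path_image_def)

text \<open>The hypotheses under which \<open>(T\<^sub>2)\<close> will be shown to imply \<open>(T\<^sub>2'')\<close>.\<close>
locale tree_graded_pieces =
  fixes \<P> :: "'a::metric_space set set"
  assumes geodesic_space: "geodesic_subset (UNIV :: 'a set)"
    and closed_piece: "M \<in> \<P> \<Longrightarrow> closed M"
    and geodesic_piece: "M \<in> \<P> \<Longrightarrow> geodesic_subset M"
    and T1: "cond_T1 \<P>"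
    and T2: "cond_T2 \<P>"
begin

lemma obtain_geodesic:
  fixes x y :: 'a
  obtains g where "geodesic_path g" "g 0 = x" "g 1 = y"
proof -
  obtain S where "geodesic_segment_between S x y"
    using geodesic_space unfolding geodesic_subset_def by blast
  then show thesis using geodesic_path_of_segment that by metis
qed

lemma obtain_geodesic_in_piece:
  assumes "M \<in> \<P>" "x \<in> M" "y \<in> M"
  obtains g where "geodesic_path g" "g 0 = x" "g 1 = y" "path_image g \<subseteq> M"
proof -
  obtain S where "geodesic_segment_between S x y" "S \<subseteq> M"
    using geodesic_piece assms unfolding geodesic_subset_def by blast
  then show thesis using geodesic_path_of_segment that by metis
qed

lemma pieces_eqI:
  assumes "M \<in> \<P>" "N \<in> \<P>" "x \<in> M" "x \<in> N" "y \<in> M" "y \<in> N" "x \<noteq> y"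
  shows "M = N"
  using T1 assms unfolding cond_T1_def by blast

text \<open>A bigon is a triangle whose third side is a point; as a parametrised loop it has its second and third
  vertex at the parameters \<open>1/2\<close> and \<open>1\<close>.\<close>
lemma geodesic_bigon_in_piece:
  assumes "geodesic_path a" "geodesic_path b" "a 1 = b 0" "b 1 = a 0" "a 0 \<noteq> a 1"
    and "path_image a \<inter> path_image b \<subseteq> {a 0, a 1}"
  shows "\<exists>N\<in>\<P>. path_image a \<union> path_image b \<subseteq> N"
proof -
  define g where "g = a +++ b"
  have arcs: "arc a" "arc b" using geodesic_path_imp_arc assms(1-5) by metis+
  have ab: "pathfinish a = pathstart b" "pathfinish b = pathstart a"
    using assms by (auto simp: pathstart_def pathfinish_def)
  have "simple_path g"
    unfolding g_def
    by (rule simple_path_join_loop[OF arcs ab]) (use assms in \<open>auto simp: pathstart_def\<close>)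
  then have "simple_loop g" using ab by (simp add: simple_loop_def g_def)
  moreover have g0: "g 0 = a 0" and gh: "g (1/2) = a 1" and g1: "g 1 = b 1"
    by (simp_all add: g_def joinpaths_def)
  moreover have i1: "g ` {0..1/2} = path_image a" and i2: "g ` {1/2..1} = path_image b"
    unfolding g_def using joinpaths_image_left joinpaths_image_right' ab(1) by blast+
  moreover have "geodesic_segment_between (g ` {0..1/2}) (g 0) (g (1/2))"
    unfolding i1 g0 gh by (rule geodesic_segment_between_path_image[OF assms(1)])
  moreover have "geodesic_segment_between (g ` {1/2..1}) (g (1/2)) (g 1)"
    unfolding i2 g1 gh assms(3) by (rule geodesic_segment_between_path_image[OF assms(2)])
  moreover have "geodesic_segment_between (g ` {1..1}) (g 1) (g 1)"
    unfolding geodesic_segment_between_def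
    by (rule exI[of _ 0], rule exI[of _ "\<lambda>_. g 1"]) auto
  ultimately have "simple_geodesic_triangle (path_image g)"
    unfolding simple_geodesic_triangle_def
    by (intro disjI2 exI[of _ g] exI[of _ "1/2"] exI[of _ 1]) auto
  moreover have "path_image g = path_image a \<union> path_image b"
    unfolding g_def by (rule path_image_join[OF ab(1)])
  ultimately show ?thesis using T2 unfolding cond_T2_def in_one_piece_def by metis
qed

lemma geodesic_triangle_in_piece:
  assumes "geodesic_path a" "geodesic_path b" "geodesic_path c"
    and "a 1 = b 0" "b 1 = c 0" "c 1 = a 0" "a 0 \<noteq> a 1" "b 0 \<noteq> b 1" "c 0 \<noteq> c 1"
    and "path_image a \<inter> path_image b \<subseteq> {a 1}" "path_image b \<inter> path_image c \<subseteq> {b 1}"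
      "path_image c \<inter> path_image a \<subseteq> {c 1}"
  shows "\<exists>N\<in>\<P>. path_image a \<union> path_image b \<union> path_image c \<subseteq> N"
proof -
  define h where "h = b +++ c"
  define g where "g = a +++ h"
  have arcs: "arc a" "arc b" "arc c" using geodesic_path_imp_arc assms(1-9) by metis+
  have bc: "pathfinish b = pathstart c" using assms by (auto simp: pathstart_def pathfinish_def)
  have "arc h"
    unfolding h_def
    by (rule arc_join[OF arcs(2,3) bc]) (use assms in \<open>auto simp: pathstart_def\<close>)
  have h: "pathstart h = b 0" "pathfinish h = c 1" "path_image h = path_image b \<union> path_image c"
    unfolding h_def path_image_join[OF bc] by (auto simp: pathstart_def pathfinish_def joinpaths_def)
  have ah: "pathfinish a = pathstart h" "pathfinish h = pathstart a"
    unfolding h using assms by (auto simp: pathstart_def pathfinish_def)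
  have "simple_path g"
    unfolding g_def
    by (rule simple_path_join_loop[OF arcs(1) \<open>arc h\<close> ah])
       (use assms h in \<open>auto simp: pathstart_def\<close>)
  then have "simple_loop g" using ah by (simp add: simple_loop_def g_def)
  moreover have g0: "g 0 = a 0" and gh: "g (1/2) = a 1" and g34: "g (3/4) = b 1" and g1: "g 1 = c 1"
    by (simp_all add: g_def h_def joinpaths_def)
  moreover have i1: "g ` {0..1/2} = path_image a"
    unfolding g_def by (rule joinpaths_image_left)
  moreover have i2: "g ` {1/2..3/4} = path_image b"
    using joinpaths_image_right[OF ah(1), of 0 "1/2"] joinpaths_image_left[of b c]
    by (simp add: g_def h_def)
  moreover have i3: "g ` {3/4..1} = path_image c"
    using joinpaths_image_right[OF ah(1), of "1/2" 1] joinpaths_image_right'[OF bc]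
    by (simp add: g_def h_def)
  moreover have "geodesic_segment_between (g ` {0..1/2}) (g 0) (g (1/2))"
    unfolding i1 g0 gh by (rule geodesic_segment_between_path_image[OF assms(1)])
  moreover have "geodesic_segment_between (g ` {1/2..3/4}) (g (1/2)) (g (3/4))"
    unfolding i2 g34 gh assms(4) by (rule geodesic_segment_between_path_image[OF assms(2)])
  moreover have "geodesic_segment_between (g ` {3/4..1}) (g (3/4)) (g 1)"
    unfolding i3 g34 g1 assms(5) by (rule geodesic_segment_between_path_image[OF assms(3)])
  ultimately have "simple_geodesic_triangle (path_image g)"
    unfolding simple_geodesic_triangle_def
    by (intro disjI2 exI[of _ g] exI[of _ "1/2"] exI[of _ "3/4"]) auto
  moreover have "path_image g = path_image a \<union> path_image b \<union> path_image c"
    unfolding g_def path_image_join[OF ah(1)] h by blast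
  ultimately show ?thesis using T2 unfolding cond_T2_def in_one_piece_def by metis
qed

text \<open>This is the form in which \<open>(T\<^sub>2)\<close> is used. Let the geodesic \<open>\<beta>\<close> close up the connected figure formed
  by the geodesics \<open>\<alpha>\<close> and \<open>\<gamma>\<close>, which share the point \<open>w\<close>. A point \<open>\<beta> t\<close> off that figure lies in a maximal open
  segment of \<open>\<beta>\<close> off it, from \<open>\<beta> f\<close> to \<open>\<beta> e\<close>. If both ends lie on \<open>\<alpha>\<close>, or both on \<open>\<gamma>\<close>, this segment spans
  a simple bigon. Otherwise walk from the end on one of \<open>\<alpha>\<close>, \<open>\<gamma>\<close> towards \<open>w\<close> until the other one is
  met, in a point \<open>r\<close>, and walk along the latter to the other end: this gives a simple triangle with third
  vertex \<open>r\<close>. The conclusion records where the ends and \<open>r\<close> lie, because (T1) will be applied to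
  these points.\<close>
lemma geodesic_side_in_piece:
  fixes \<alpha> \<beta> \<gamma> :: "real \<Rightarrow> 'a"
  assumes geo: "geodesic_path \<alpha>" "geodesic_path \<beta>" "geodesic_path \<gamma>"
    and w: "w \<in> path_image \<alpha>" "w \<in> path_image \<gamma>"
    and ends: "\<beta> 0 \<in> path_image \<alpha> \<union> path_image \<gamma>" "\<beta> 1 \<in> path_image \<alpha> \<union> path_image \<gamma>"
    and t: "t \<in> {0..1}" "\<beta> t \<notin> path_image \<alpha> \<union> path_image \<gamma>"
  obtains f e N where "0 \<le> f" "f < t" "t < e" "e \<le> 1" "N \<in> \<P>" "\<beta> ` {f..e} \<subseteq> N"
    "\<beta> f \<in> path_image \<alpha> \<union> path_image \<gamma>" "\<beta> e \<in> path_image \<alpha> \<union> path_image \<gamma>"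
    "\<beta> f \<in> path_image \<alpha> \<and> \<beta> e \<in> path_image \<alpha> \<or> \<beta> f \<in> path_image \<gamma> \<and> \<beta> e \<in> path_image \<gamma> \<or>
     (\<exists>r\<in>N. r \<in> path_image \<alpha> \<and> r \<in> path_image \<gamma>)"
proof -
  define U where "U = path_image \<alpha> \<union> path_image \<gamma>"
  have closedU: "closed U" unfolding U_def by (intro closed_Un closed_geodesic_image geo)
  have cont: "continuous_on {0..1} \<beta>" using geodesic_path_imp_path[OF geo(2)] by (simp add: path_def)
  have "\<beta> t \<notin> U" using t by (simp add: U_def)
  obtain e where e: "t \<le> e" "e \<le> 1" "\<beta> e \<in> U" "\<And>x. t \<le> x \<Longrightarrow> x < e \<Longrightarrow> \<beta> x \<notin> U"
  proof (rule first_hit[of t 1 \<beta> U])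
    show "continuous_on {t..1} \<beta>" by (rule continuous_on_subset[OF cont]) (use t in auto)
  qed (use closedU ends t in \<open>auto simp: U_def\<close>)
  obtain f where f: "0 \<le> f" "f \<le> t" "\<beta> f \<in> U" "\<And>x. f < x \<Longrightarrow> x \<le> t \<Longrightarrow> \<beta> x \<notin> U"
  proof (rule last_hit[of 0 t \<beta> U])
    show "continuous_on {0..t} \<beta>" by (rule continuous_on_subset[OF cont]) (use t in auto)
  qed (use closedU ends t in \<open>auto simp: U_def\<close>)
  have fte: "f < t" "t < e" using e(1,3) f(2,3) \<open>\<beta> t \<notin> U\<close> by (auto simp: less_le)
  have fe01: "f \<in> {0..1}" "e \<in> {0..1}" using fte e f by auto
  have inner: "x = f \<or> x = e" if "x \<in> {f..e}" "\<beta> x \<in> U" for x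
    using e(4)[of x] f(4)[of x] that by fastforce
  have "\<beta> 0 \<noteq> \<beta> 1"
  proof
    assume "\<beta> 0 = \<beta> 1"
    then have "\<beta> t \<in> {\<beta> 0}" using path_image_const_geodesic[OF geo(2)] t(1) by (auto simp: path_image_def)
    then show False using ends(1) t(2) by simp
  qed
  then have ne: "\<beta> f \<noteq> \<beta> e" using geodesic_path_inj[OF geo(2) _ fe01] fte by simp
  have bigon: "\<exists>N\<in>\<P>. \<beta> ` {f..e} \<subseteq> N"
    if \<delta>: "geodesic_path \<delta>" "path_image \<delta> \<subseteq> U" "\<beta> f \<in> path_image \<delta>" "\<beta> e \<in> path_image \<delta>" for \<delta>
  proof -
    obtain p q where pq: "p \<in> {0..1}" "q \<in> {0..1}" "\<delta> p = \<beta> e" "\<delta> q = \<beta> f"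
      using \<delta>(3,4) by (auto simp: path_image_def)
    have img: "path_image (subarc f e \<beta>) = \<beta> ` {f..e}" using fte by (simp add: path_image_subarc_le)
    have "path_image (subarc p q \<delta>) \<subseteq> U" using path_image_subarc_subset[OF pq(1,2), of \<delta>] \<delta>(2) by blast
    then have "path_image (subarc f e \<beta>) \<inter> path_image (subarc p q \<delta>) \<subseteq> {\<beta> f, \<beta> e}"
      unfolding img using inner by blast
    then have "\<exists>N\<in>\<P>. \<beta> ` {f..e} \<union> path_image (subarc p q \<delta>) \<subseteq> N"
      using geodesic_bigon_in_piece[OF geodesic_path_subarc[OF geo(2) fe01]
          geodesic_path_subarc[OF \<delta>(1) pq(1,2)]] ne pq unfolding img by simp
    then show ?thesis by blast
  qed
  \<comment> \<open>Stated for \<open>p\<close>, \<open>q\<close> in either order, so that it covers both ways in which the ends can be shared out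
    between \<open>\<alpha>\<close> and \<open>\<gamma>\<close>.\<close>
  have triangle: "\<exists>N\<in>\<P>. \<beta> ` {f..e} \<subseteq> N \<and> (\<exists>r\<in>N. r \<in> path_image \<delta> \<and> r \<in> path_image \<epsilon>)"
    if \<delta>\<epsilon>: "geodesic_path \<delta>" "geodesic_path \<epsilon>" "path_image \<delta> \<subseteq> U" "path_image \<epsilon> \<subseteq> U"
        "w \<in> path_image \<delta>" "w \<in> path_image \<epsilon>"
      and pq: "p \<in> {0..1}" "q \<in> {0..1}" "closed_segment p q = {f..e}" "{p, q} = {f, e}"
      and p: "\<beta> p \<in> path_image \<epsilon>" "\<beta> p \<notin> path_image \<delta>"
      and q: "\<beta> q \<in> path_image \<delta>" "\<beta> q \<notin> path_image \<epsilon>" for \<delta> \<epsilon> p q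
  proof -
    obtain p' w' where pw: "p' \<in> {0..1}" "w' \<in> {0..1}" "\<epsilon> p' = \<beta> p" "\<epsilon> w' = w"
      using p(1) \<delta>\<epsilon>(6) by (auto simp: path_image_def)
    define k where "k = subarc p' w' \<epsilon>"
    have k: "geodesic_path k" "k 0 = \<beta> p" "k 1 = w" "path_image k \<subseteq> path_image \<epsilon>"
      unfolding k_def
      using pw geodesic_path_subarc[OF \<delta>\<epsilon>(2) pw(1,2)] path_image_subarc_subset[OF pw(1,2)] by simp_all
    obtain u where u: "0 \<le> u" "u \<le> 1" "k u \<in> path_image \<delta>"
      "\<And>x. 0 \<le> x \<Longrightarrow> x < u \<Longrightarrow> k x \<notin> path_image \<delta>"
    proof (rule first_hit[of 0 1 k "path_image \<delta>"])
      show "continuous_on {0..1} k" using geodesic_path_imp_path[OF k(1)] by (simp add: path_def)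
    qed (use closed_geodesic_image[OF \<delta>\<epsilon>(1)] k(3) \<delta>\<epsilon>(5) in auto)
    define r where "r = k u"
    have r\<epsilon>: "r \<in> path_image \<epsilon>" using k(4) u(1,2) by (auto simp: r_def path_image_def)
    have r\<delta>: "r \<in> path_image \<delta>" using u by (simp add: r_def)
    define c where "c = subarc 0 u k"
    have c: "geodesic_path c" "c 0 = \<beta> p" "c 1 = r" "path_image c \<subseteq> path_image \<epsilon>"
      unfolding c_def r_def
      using u k geodesic_path_subarc[OF k(1), of 0 u] path_image_subarc_subset[of 0 u k] by auto
    have c\<delta>: "path_image c \<inter> path_image \<delta> \<subseteq> {r}"
    proof
      fix x assume x: "x \<in> path_image c \<inter> path_image \<delta>"
      then obtain s where "s \<in> {0..u}" "x = k s" using u by (auto simp: c_def path_image_subarc_le)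
      then show "x \<in> {r}" using u(4)[of s] x by (cases "s = u") (auto simp: r_def)
    qed
    obtain r' q' where rq: "r' \<in> {0..1}" "q' \<in> {0..1}" "\<delta> r' = r" "\<delta> q' = \<beta> q"
      using q(1) r\<delta> by (auto simp: path_image_def)
    define d where "d = subarc r' q' \<delta>"
    have d: "geodesic_path d" "d 0 = r" "d 1 = \<beta> q" "path_image d \<subseteq> path_image \<delta>"
      unfolding d_def
      using rq geodesic_path_subarc[OF \<delta>\<epsilon>(1) rq(1,2)] path_image_subarc_subset[OF rq(1,2)] by simp_all
    define b where "b = subarc q p \<beta>"
    have b: "geodesic_path b" "b 0 = \<beta> q" "b 1 = \<beta> p"
      unfolding b_def using geodesic_path_subarc[OF geo(2) pq(2,1)] by simp_all
    have b_image: "path_image b = \<beta> ` {f..e}"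
      by (simp only: b_def path_image_subarc closed_segment_commute[of q p] pq(3))
    have bU: "path_image b \<inter> U \<subseteq> {\<beta> p, \<beta> q}"
    proof
      fix x assume "x \<in> path_image b \<inter> U"
      then obtain s where s: "s \<in> {f..e}" "x = \<beta> s" "\<beta> s \<in> U" unfolding b_image by blast
      then have "s \<in> {p, q}" using inner[OF s(1,3)] unfolding pq(4) by simp
      then show "x \<in> {\<beta> p, \<beta> q}" using s(2) by auto
    qed
    have "\<exists>N\<in>\<P>. path_image c \<union> path_image d \<union> path_image b \<subseteq> N"
    proof (rule geodesic_triangle_in_piece[OF c(1) d(1) b(1)])
      show "c 0 \<noteq> c 1" using c p(2) r\<delta> by auto
      show "d 0 \<noteq> d 1" using d q(2) r\<epsilon> by auto
      show "b 0 \<noteq> b 1" using b p q by auto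
      show "path_image c \<inter> path_image d \<subseteq> {c 1}" using c\<delta> d(4) c(3) by auto
      show "path_image d \<inter> path_image b \<subseteq> {d 1}"
        using bU d(3,4) \<delta>\<epsilon>(3) p(2) by auto
      show "path_image b \<inter> path_image c \<subseteq> {b 1}"
        using bU b(3) c(4) \<delta>\<epsilon>(4) q(2) by auto
    qed (use b c d in auto)
    then obtain N where "N \<in> \<P>" "path_image c \<union> path_image d \<union> path_image b \<subseteq> N" by blast
    moreover have "r \<in> path_image c" using c(3) by (force simp: path_image_def)
    ultimately show ?thesis using b_image r\<delta> r\<epsilon> by blast
  qed
  have sub: "path_image \<alpha> \<subseteq> U" "path_image \<gamma> \<subseteq> U" by (auto simp: U_def)
  have seg: "closed_segment f e = {f..e}" "closed_segment e f = {f..e}"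
    using fte by (auto simp: closed_segment_eq_real_ivl)
  note result = that[OF f(1) fte e(2) _ _ f(3)[unfolded U_def] e(3)[unfolded U_def]]
  consider "\<beta> f \<in> path_image \<alpha>" "\<beta> e \<in> path_image \<alpha>"
    | "\<beta> f \<in> path_image \<gamma>" "\<beta> e \<in> path_image \<gamma>"
    | "\<beta> f \<in> path_image \<gamma>" "\<beta> f \<notin> path_image \<alpha>" "\<beta> e \<in> path_image \<alpha>" "\<beta> e \<notin> path_image \<gamma>"
    | "\<beta> e \<in> path_image \<gamma>" "\<beta> e \<notin> path_image \<alpha>" "\<beta> f \<in> path_image \<alpha>" "\<beta> f \<notin> path_image \<gamma>"
    using e(3) f(3) by (auto simp: U_def)
  then show thesis
  proof cases
    case 1
    then show ?thesis using bigon[OF geo(1) sub(1)] result by blast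
  next
    case 2
    then show ?thesis using bigon[OF geo(3) sub(2)] result by blast
  next
    case 3
    then show ?thesis
      using triangle[OF geo(1,3) sub w fe01 seg(1) _ 3] result by blast
  next
    case 4
    then show ?thesis
      using triangle[OF geo(1,3) sub w fe01(2,1) seg(2) _ 4] result by blast
  qed
qed

end

section \<open>Gates of points in pieces\<close>

text \<open>The point \<open>y\<close> is the projection of \<open>x\<close> to \<open>M\<close>, in the strong sense that the way from \<open>x\<close> to any
  point of \<open>M\<close> may lead through \<open>y\<close>.\<close>
definition is_gate :: "'a::metric_space set \<Rightarrow> 'a \<Rightarrow> 'a \<Rightarrow> bool" where
  "is_gate M x y \<longleftrightarrow> y \<in> M \<and> (\<forall>b\<in>M. dist x b = dist x y + dist y b)"

lemma is_gate_mem: "is_gate M x y \<Longrightarrow> y \<in> M"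
  and is_gate_dist: "is_gate M x y \<Longrightarrow> b \<in> M \<Longrightarrow> dist x b = dist x y + dist y b"
  unfolding is_gate_def by blast+

lemma is_gate_unique:
  assumes "is_gate M x y" "is_gate M x y'"
  shows "y = y'"
proof -
  have "dist x y' = dist x y + dist y y'" "dist x y = dist x y' + dist y' y"
    using assms unfolding is_gate_def by blast+
  then have "dist y y' + dist y' y = 0" by linarith
  then show ?thesis by (simp add: dist_commute)
qed

lemma is_gate_self: "x \<in> M \<Longrightarrow> is_gate M x x"
  by (simp add: is_gate_def)

lemma is_gate_on_geodesic:
  assumes "geodesic_path g" "is_gate M (g 0) (g 1)" "z \<in> path_image g" "z \<in> M"
  shows "z = g 1"
proof -
  have "dist (g 0) z = dist (g 0) (g 1) + dist (g 1) z" using assms(2,4) by (rule is_gate_dist)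
  with geodesic_path_dist_sum[OF assms(1,3)] have "dist z (g 1) + dist (g 1) z = 0" by linarith
  then show ?thesis by (simp add: dist_commute)
qed

context tree_graded_pieces
begin

text \<open>Take the point \<open>y\<close> at which some geodesic from \<open>x\<close> first meets \<open>M\<close>. If a geodesic \<open>\<gamma>\<close> from \<open>x\<close> to
  \<open>b \<in> M\<close> missed \<open>y\<close>, then \<open>\<gamma>\<close>, the geodesic from \<open>x\<close> to \<open>y\<close> and one in \<open>M\<close> from \<open>y\<close> to \<open>b\<close> would yield
  a simple triangle in a piece \<open>N\<close> which meets \<open>M\<close> in two points, although it leaves \<open>M\<close>.\<close>
lemma gate_exists:
  assumes M: "M \<in> \<P>" "a \<in> M"
  obtains y where "is_gate M x y"
proof (cases "x \<in> M")
  case True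
  then show ?thesis using that is_gate_self by blast
next
  case False
  obtain g where g: "geodesic_path g" "g 0 = x" "g 1 = a" by (rule obtain_geodesic)
  obtain u where u: "0 \<le> u" "u \<le> 1" "g u \<in> M" "\<And>s. 0 \<le> s \<Longrightarrow> s < u \<Longrightarrow> g s \<notin> M"
  proof (rule first_hit[of 0 1 g M])
    show "continuous_on {0..1} g" using geodesic_path_imp_path[OF g(1)] by (simp add: path_def)
  qed (use closed_piece M g in auto)
  have "0 < u" using u(1,3) g(2) False by (auto simp: less_le)
  define y where "y = g u"
  define \<beta> where "\<beta> = subarc 0 u g"
  have \<beta>: "geodesic_path \<beta>" "\<beta> 0 = x" "\<beta> 1 = y"
    using u g geodesic_path_subarc[OF g(1)] by (auto simp: \<beta>_def y_def)
  have \<beta>M: "\<beta> s \<notin> M" if "0 \<le> s" "s < 1" for s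
    using u(4)[of "u * s"] that \<open>0 < u\<close> by (simp add: \<beta>_def subarc_def)
  have "y \<in> M" using u by (simp add: y_def)
  have "dist x b = dist x y + dist y b" if b: "b \<in> M" for b
  proof -
    obtain \<alpha> where \<alpha>: "geodesic_path \<alpha>" "\<alpha> 0 = y" "\<alpha> 1 = b" "path_image \<alpha> \<subseteq> M"
      using obtain_geodesic_in_piece[OF M(1) \<open>y \<in> M\<close> b] .
    obtain \<gamma> where \<gamma>: "geodesic_path \<gamma>" "\<gamma> 0 = x" "\<gamma> 1 = b" by (rule obtain_geodesic)
    have ends: "b \<in> path_image \<alpha>" "b \<in> path_image \<gamma>" "x \<in> path_image \<gamma>" "y \<in> path_image \<alpha>"
      using pathstart_in_path_image[of \<alpha>] pathfinish_in_path_image[of \<alpha>]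
        pathstart_in_path_image[of \<gamma>] pathfinish_in_path_image[of \<gamma>] \<alpha> \<gamma>
      by (auto simp: pathstart_def pathfinish_def)
    have "y \<in> path_image \<gamma>"
    proof (rule ccontr)
      assume y: "y \<notin> path_image \<gamma>"
      \<comment> \<open>Beyond \<open>t0\<close> the curve \<open>\<beta>\<close> avoids \<open>\<gamma>\<close>, and \<open>M\<close> contains none of it but \<open>y\<close>; hence the segment found
        around \<open>t > t0\<close> ends in \<open>y\<close>.\<close>
      obtain t0 where t0: "0 \<le> t0" "t0 \<le> 1" "\<beta> t0 \<in> path_image \<gamma>"
        "\<And>s. t0 < s \<Longrightarrow> s \<le> 1 \<Longrightarrow> \<beta> s \<notin> path_image \<gamma>"
      proof (rule last_hit[of 0 1 \<beta> "path_image \<gamma>"])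
        show "continuous_on {0..1} \<beta>" using geodesic_path_imp_path[OF \<beta>(1)] by (simp add: path_def)
      qed (use closed_geodesic_image[OF \<gamma>(1)] \<beta> ends in auto)
      have "t0 < 1" using t0(2,3) y \<beta>(3) by (auto simp: less_le)
      define t where "t = (t0 + 1) / 2"
      have t: "t0 < t" "t < 1" "t \<in> {0..1}" using \<open>t0 < 1\<close> t0(1) by (auto simp: t_def)
      have "\<beta> t \<notin> path_image \<alpha> \<union> path_image \<gamma>"
        using \<beta>M[of t] t t0(4)[of t] \<alpha>(4) by auto
      then obtain f e N where feN: "0 \<le> f" "f < t" "t < e" "e \<le> 1" "N \<in> \<P>" "\<beta> ` {f..e} \<subseteq> N"
        "\<beta> f \<in> path_image \<alpha> \<union> path_image \<gamma>" "\<beta> e \<in> path_image \<alpha> \<union> path_image \<gamma>"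
        "\<beta> f \<in> path_image \<alpha> \<and> \<beta> e \<in> path_image \<alpha> \<or> \<beta> f \<in> path_image \<gamma> \<and> \<beta> e \<in> path_image \<gamma> \<or>
         (\<exists>r\<in>N. r \<in> path_image \<alpha> \<and> r \<in> path_image \<gamma>)"
        using geodesic_side_in_piece[OF \<alpha>(1) \<beta>(1) \<gamma>(1) ends(1,2) _ _ t(3)] \<beta>(2,3) ends by auto
      have e\<gamma>: "\<beta> e \<notin> path_image \<gamma>" using t0(4)[of e] feN t by auto
      then have "\<beta> e \<in> M" using feN(8) \<alpha>(4) by blast
      then have "e = 1" using \<beta>M[of e] feN t t0(1) by force
      have "\<beta> f \<notin> path_image \<alpha>" using \<beta>M[of f] feN t \<alpha>(4) by auto
      then obtain r where r: "r \<in> N" "r \<in> path_image \<alpha>" "r \<in> path_image \<gamma>" using feN(9) e\<gamma> by blast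
      have "y \<in> N" using feN \<open>e = 1\<close> \<beta>(3) by auto
      then have "N = M" using pieces_eqI[OF feN(5) M(1) r(1) _ _ \<open>y \<in> M\<close>] r y \<alpha>(4) by blast
      moreover have "\<beta> t \<in> N" using feN by auto
      ultimately show False using \<beta>M[of t] t by simp
    qed
    from geodesic_path_dist_sum[OF \<gamma>(1) this] show ?thesis using \<gamma> by simp
  qed
  then show ?thesis using that \<open>y \<in> M\<close> unfolding is_gate_def by blast
qed

text \<open>If the gates \<open>y\<close> and \<open>y'\<close> differ, the way \<open>\<beta>\<close> from \<open>x = \<gamma> 0\<close> through \<open>y\<close> to \<open>y'\<close> is a geodesic. Its part in
  \<open>M\<close> meets \<open>\<gamma>\<close> and the geodesic \<open>\<alpha>\<close> from \<open>\<gamma> 1\<close> to \<open>y'\<close> in \<open>y'\<close> only. So a piece around a point of that part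
  extends up to \<open>y'\<close>; it is therefore \<open>M\<close>, and both ends of its segment on \<open>\<beta>\<close> would have to be \<open>y'\<close>.\<close>
lemma gate_eq_along_geodesic:
  assumes M: "M \<in> \<P>" and \<gamma>: "geodesic_path \<gamma>" "path_image \<gamma> \<inter> M = {}"
    and y: "is_gate M (\<gamma> 0) y" and y': "is_gate M (\<gamma> 1) y'"
  shows "y = y'"
proof (rule ccontr)
  assume "y \<noteq> y'"
  define x x' where "x = \<gamma> 0" and "x' = \<gamma> 1"
  have yM: "y \<in> M" "y' \<in> M" using y y' by (simp_all add: is_gate_mem)
  obtain a where a: "geodesic_path a" "a 0 = x" "a 1 = y" by (rule obtain_geodesic)
  obtain m where m: "geodesic_path m" "m 0 = y" "m 1 = y'" "path_image m \<subseteq> M"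
    using obtain_geodesic_in_piece[OF M yM] .
  obtain \<alpha> where \<alpha>: "geodesic_path \<alpha>" "\<alpha> 0 = x'" "\<alpha> 1 = y'" by (rule obtain_geodesic)
  have "dist (a 0) (m 1) = dist (a 0) (a 1) + dist (m 0) (m 1)"
    unfolding a m x_def by (rule is_gate_dist[OF y yM(2)])
  then obtain \<beta> where \<beta>: "geodesic_path \<beta>" "\<beta> 0 = x" "\<beta> 1 = y'" "path_image \<beta> = path_image a \<union> path_image m"
    using geodesic_path_concat[OF a(1) m(1)] a m by metis
  have ends: "x' \<in> path_image \<alpha>" "x' \<in> path_image \<gamma>" "x \<in> path_image \<gamma>" "y' \<in> path_image \<alpha>"
    using pathstart_in_path_image[of \<alpha>] pathfinish_in_path_image[of \<alpha>]
      pathstart_in_path_image[of \<gamma>] pathfinish_in_path_image[of \<gamma>] \<alpha>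
    by (auto simp: pathstart_def pathfinish_def x_def x'_def)
  have \<alpha>M: "z = y'" if "z \<in> path_image \<alpha>" "z \<in> M" for z
    using is_gate_on_geodesic[OF \<alpha>(1) _ that] \<alpha> y' by (simp add: x'_def)
  define z where "z = m (1/2)"
  have zm: "z \<in> path_image m" by (auto simp: z_def path_image_def)
  then have zM: "z \<in> M" using m by blast
  have "z \<noteq> y'" using geodesic_path_inj[OF m(1), of "1/2" 1] m \<open>y \<noteq> y'\<close> by (simp add: z_def)
  obtain t where t: "t \<in> {0..1}" "\<beta> t = z"
    using UnI2[OF zm, of "path_image a", folded \<beta>(4)] by (auto simp: path_image_def)
  have t_out: "\<beta> t \<notin> path_image \<alpha> \<union> path_image \<gamma>"
    using t \<alpha>M[of z] zM zm \<open>z \<noteq> y'\<close> \<gamma>(2) by auto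
  obtain f e N where feN: "0 \<le> f" "f < t" "t < e" "e \<le> 1" "N \<in> \<P>" "\<beta> ` {f..e} \<subseteq> N"
    "\<beta> f \<in> path_image \<alpha> \<union> path_image \<gamma>" "\<beta> e \<in> path_image \<alpha> \<union> path_image \<gamma>"
    by (rule geodesic_side_in_piece[OF \<alpha>(1) \<beta>(1) \<gamma>(1) ends(1,2) _ _ t(1) t_out])
       (use \<beta>(2,3) ends in auto)
  have fe01: "f \<in> {0..1}" "e \<in> {0..1}" using feN by auto
  have dxy': "dist x y' = dist x y + dist y y'" unfolding x_def by (rule is_gate_dist[OF y yM(2)])
  have L: "dist x y' > 0" using \<open>y \<noteq> y'\<close> dxy' by (metis add_nonneg_pos zero_le_dist zero_less_dist_iff)
  have "\<beta> e \<in> M"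
  proof (rule ccontr)
    assume "\<beta> e \<notin> M"
    then have "\<beta> e \<in> path_image a" using \<beta>(4) m(4) fe01(2) unfolding path_image_def by blast
    from geodesic_path_dist_le[OF a(1) this] have "dist x (\<beta> e) \<le> dist x y" unfolding a .
    moreover have "dist x z = dist x y + dist y z" unfolding x_def by (rule is_gate_dist[OF y zM])
    moreover have "dist x (\<beta> e) = dist x y' * e" "dist x z = dist x y' * t"
      using geodesic_path_dist_0[OF \<beta>(1) fe01(2)] geodesic_path_dist_0[OF \<beta>(1) t(1)] \<beta> t by simp_all
    moreover have "dist x y' * t < dist x y' * e" using L feN(3) by simp
    ultimately show False using zero_le_dist[of y z] by linarith
  qed
  then have e: "\<beta> e = y'" using \<alpha>M[of "\<beta> e"] feN(8) \<gamma>(2) by blast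
  have "\<beta> e \<in> N" "\<beta> t \<in> N" "\<beta> f \<in> N" using feN by auto
  then have "N = M" using pieces_eqI[OF feN(5) M, of y' z] e t yM zM \<open>z \<noteq> y'\<close> by auto
  then have "\<beta> f = y'" using \<alpha>M[of "\<beta> f"] feN(7) \<gamma>(2) \<open>\<beta> f \<in> N\<close> by blast
  moreover have "\<beta> 0 \<noteq> \<beta> 1" using L \<beta> by auto
  ultimately show False using geodesic_path_inj[OF \<beta>(1) _ fe01] e feN by simp
qed

text \<open>Geodesics between nearby points off \<open>M\<close> stay off \<open>M\<close>, so that the gate is locally constant there.\<close>
lemma gate_eq_on_connected:
  assumes M: "M \<in> \<P>" and S: "connected S" "S \<inter> M = {}" "x \<in> S" "x' \<in> S"
    and y: "is_gate M x y" and y': "is_gate M x' y'"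
  shows "y = y'"
proof -
  define \<pi> where "\<pi> w = (SOME y. is_gate M w y)" for w
  have "y \<in> M" using y by (rule is_gate_mem)
  have \<pi>: "is_gate M w (\<pi> w)" for w
    unfolding \<pi>_def using gate_exists[OF M \<open>y \<in> M\<close>] by (metis someI)
  have "\<pi> x = \<pi> x'"
  proof (rule connected_local_const[OF S(1,3,4)], rule ballI)
    fix a assume "a \<in> S"
    then have "a \<in> - M" using S(2) by blast
    moreover have "open (- M)" using closed_piece[OF M] by (simp add: open_Compl)
    ultimately obtain \<epsilon> where \<epsilon>: "\<epsilon> > 0" "ball a \<epsilon> \<subseteq> - M" by (meson openE)
    have "\<pi> a = \<pi> b" if "dist b a < \<epsilon>" for b
    proof -
      obtain \<gamma> where \<gamma>: "geodesic_path \<gamma>" "\<gamma> 0 = a" "\<gamma> 1 = b" by (rule obtain_geodesic)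
      have "z \<in> ball a \<epsilon>" if z: "z \<in> path_image \<gamma>" for z
        using geodesic_path_dist_le[OF \<gamma>(1) z] \<open>dist b a < \<epsilon>\<close> unfolding \<gamma>(2,3)
        by (simp add: dist_commute)
      then have "path_image \<gamma> \<inter> M = {}" using \<epsilon> by blast
      from gate_eq_along_geodesic[OF M \<gamma>(1) this, unfolded \<gamma>(2,3), OF \<pi> \<pi>] show ?thesis .
    qed
    then show "eventually (\<lambda>b. \<pi> a = \<pi> b) (at a within S)"
      unfolding eventually_at using \<epsilon>(1) by blast
  qed
  then show ?thesis using is_gate_unique \<pi> y y' by metis
qed

text \<open>Until the path first meets \<open>M\<close>, its gate is constantly \<open>y\<close>, and the distance from the path to \<open>y\<close> tends to
  \<open>0\<close> as that moment approaches: the path enters \<open>M\<close> at \<open>y\<close>.\<close>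
lemma gate_in_path_image:
  assumes M: "M \<in> \<P>" and c: "path c" "c 1 \<in> M" and y: "is_gate M (c 0) y"
  shows "y \<in> path_image c"
proof -
  have cont: "continuous_on {0..1} c" using c(1) by (simp add: path_def)
  obtain u where u: "0 \<le> u" "u \<le> 1" "c u \<in> M" "\<And>s. 0 \<le> s \<Longrightarrow> s < u \<Longrightarrow> c s \<notin> M"
    by (rule first_hit[OF cont closed_piece[OF M] _ c(2)]) auto
  have "y = c u"
  proof (cases "u = 0")
    case True
    then show ?thesis using is_gate_unique[OF y] is_gate_self u(3) by metis
  next
    case False
    then have "0 < u" using u by simp
    define S where "S = c ` {0..<u}"
    have "connected S"
      unfolding S_def using u by (intro connected_continuous_image continuous_on_subset[OF cont]) auto
    moreover have "S \<inter> M = {}" using u(4) by (auto simp: S_def)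
    moreover have "c 0 \<in> S" using \<open>0 < u\<close> by (auto simp: S_def)
    ultimately have gate: "is_gate M (c s) y" if "s \<in> {0..<u}" for s
      using gate_eq_on_connected[OF M, of S "c 0" "c s"] gate_exists[OF M u(3), of "c s"] y that
      unfolding S_def by (metis imageI)
    define \<phi> where "\<phi> s = dist (c s) (c u) - dist (c s) y - dist y (c u)" for s
    have cl: "closure {0..<u} = {0..u}" using \<open>0 < u\<close> by simp
    have "\<phi> u = 0"
    proof (rule continuous_constant_on_closure[where S = "{0..<u}" and f = \<phi>])
      have "continuous_on {0..u} c" by (rule continuous_on_subset[OF cont]) (use u in auto)
      then show "continuous_on (closure {0..<u}) \<phi>"
        unfolding cl \<phi>_def by (intro continuous_intros)
      show "\<phi> s = 0" if "s \<in> {0..<u}" for s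
        using is_gate_dist[OF gate[OF that] u(3)] by (simp add: \<phi>_def)
      show "u \<in> closure {0..<u}" using \<open>0 < u\<close> unfolding cl by simp
    qed
    then have "dist (c u) y + dist y (c u) = 0" by (simp add: \<phi>_def)
    then show ?thesis by (simp add: dist_commute)
  qed
  then show ?thesis using u by (auto simp: path_image_def)
qed

text \<open>From \<open>z\<close>, both halves of the arc lead into \<open>M\<close>, so both contain the gate of \<open>z\<close>. As the halves share
  only \<open>z\<close>, the point \<open>z\<close> is its own gate.\<close>
lemma arc_in_piece:
  assumes M: "M \<in> \<P>" and c: "arc c" "c 0 \<in> M" "c 1 \<in> M"
  shows "path_image c \<subseteq> M"
proof
  fix z assume "z \<in> path_image c"
  then obtain t where t: "t \<in> {0..1}" "z = c t" by (auto simp: path_image_def)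
  obtain y where y: "is_gate M z y" using gate_exists[OF M c(2)] .
  have c': "path c" "inj_on c {0..1}" using c(1) by (auto simp: arc_def)
  have 01: "0 \<in> {0..1::real}" "1 \<in> {0..1::real}" by auto
  have "y \<in> path_image (subarc t 0 c)"
    by (rule gate_in_path_image[OF M path_subarc[OF c'(1) t(1) 01(1)]]) (use c y t in auto)
  moreover have "y \<in> path_image (subarc t 1 c)"
    by (rule gate_in_path_image[OF M path_subarc[OF c'(1) t(1) 01(2)]]) (use c y t in auto)
  moreover have "closed_segment t 0 = {0..t}" "closed_segment t 1 = {t..1}"
    using t(1) by (auto simp: closed_segment_eq_real_ivl)
  ultimately obtain r s where rs: "r \<in> {0..t}" "y = c r" "s \<in> {t..1}" "y = c s"
    unfolding path_image_subarc by auto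
  then have "r = s" using inj_onD[OF c'(2), of r s] t(1) by auto
  then have "y = z" using rs t by auto
  then show "z \<in> M" using is_gate_mem[OF y] by simp
qed

lemma loop_in_piece:
  assumes M: "M \<in> \<P>" and g: "simple_loop g"
    and xy: "x \<in> path_image g" "y \<in> path_image g" "x \<in> M" "y \<in> M" "x \<noteq> y"
  shows "path_image g \<subseteq> M"
proof -
  obtain c d where cd: "arc c" "arc d" "pathstart c = x" "pathfinish c = y"
    "pathstart d = y" "pathfinish d = x" "path_image c \<union> path_image d = path_image g"
    using simple_loop_double_arc[OF g xy(1,2,5)] by metis
  have "path_image c \<subseteq> M" "path_image d \<subseteq> M"
    using arc_in_piece[OF M] cd xy by (auto simp: pathstart_def pathfinish_def)
  then show ?thesis using cd(7) by blast
qed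

section \<open>Cut points and simple loops\<close>

text \<open>Let \<open>p = h 1\<close>, and call \<open>w\<close> a point behind \<open>z\<close> if a shortest way from \<open>w\<close> to \<open>p\<close> passes through \<open>z\<close>. The
  start of \<open>h\<close> lies behind \<open>z\<close>, its end does not. Suppose a geodesic \<open>\<gamma>\<close> avoiding \<open>z\<close> led from a point behind
  \<open>z\<close> to one that is not. Then the shortest way \<open>\<beta>\<close> from \<open>\<gamma> 0\<close> through \<open>z\<close> to \<open>p\<close> and the detour by \<open>\<gamma>\<close> and a
  geodesic from \<open>\<gamma> 1\<close> to \<open>p\<close> would put \<open>z\<close> into a piece together with a point of \<open>h\<close> beyond \<open>z\<close>, which is
  excluded. So being behind \<open>z\<close> is locally constant off \<open>z\<close>, and no path off \<open>z\<close> joins the ends of \<open>h\<close>.\<close>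
lemma geodesic_cut_point:
  assumes h: "geodesic_path h" and t: "t \<in> {0..1}" and z: "h t = z" "z \<noteq> h 1"
    and isolated: "\<And>N s. N \<in> \<P> \<Longrightarrow> z \<in> N \<Longrightarrow> s \<in> {0..1} \<Longrightarrow> h s \<in> N \<Longrightarrow> h s = z"
    and c: "path c" "c 0 = h 0" "c 1 = h 1"
  shows "z \<in> path_image c"
proof (rule ccontr)
  assume zc: "z \<notin> path_image c"
  define p where "p = h 1"
  define through where "through w \<longleftrightarrow> dist w p = dist w z + dist z p" for w
  define b where "b = subarc t 1 h"
  have b: "geodesic_path b" "b 0 = z" "b 1 = p" "path_image b \<subseteq> path_image h"
    using h t z geodesic_path_subarc[OF h t, of 1] path_image_subarc_subset[OF t, of 1 h]
    by (auto simp: b_def p_def)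
  have step: "through (\<gamma> 1)" if \<gamma>: "geodesic_path \<gamma>" "z \<notin> path_image \<gamma>" "through (\<gamma> 0)" for \<gamma>
  proof (rule ccontr)
    assume not: "\<not> through (\<gamma> 1)"
    obtain \<alpha> where \<alpha>: "geodesic_path \<alpha>" "\<alpha> 0 = \<gamma> 1" "\<alpha> 1 = p" by (rule obtain_geodesic)
    have z\<alpha>: "z \<notin> path_image \<alpha>"
      using geodesic_path_dist_sum[OF \<alpha>(1)] \<alpha> not unfolding through_def by metis
    obtain a where a: "geodesic_path a" "a 0 = \<gamma> 0" "a 1 = z" by (rule obtain_geodesic)
    have L: "dist (\<gamma> 0) p = dist (\<gamma> 0) z + dist z p" using \<gamma>(3) by (simp add: through_def)
    then obtain \<beta> where \<beta>: "geodesic_path \<beta>" "\<beta> 0 = \<gamma> 0" "\<beta> 1 = p" "path_image \<beta> = path_image a \<union> path_image b"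
      using geodesic_path_concat[OF a(1) b(1)] a b by metis
    have "z \<in> path_image \<beta>"
      using \<beta>(4) pathstart_in_path_image[of b] b by (simp add: pathstart_def)
    then obtain r where r: "r \<in> {0..1}" "\<beta> r = z" by (auto simp: path_image_def)
    have ends: "\<gamma> 1 \<in> path_image \<alpha>" "\<gamma> 1 \<in> path_image \<gamma>" "\<gamma> 0 \<in> path_image \<gamma>" "p \<in> path_image \<alpha>"
      using pathstart_in_path_image[of \<alpha>] pathfinish_in_path_image[of \<alpha>]
        pathstart_in_path_image[of \<gamma>] pathfinish_in_path_image[of \<gamma>] \<alpha>
      by (auto simp: pathstart_def pathfinish_def)
    obtain f e N where feN: "0 \<le> f" "f < r" "r < e" "e \<le> 1" "N \<in> \<P>" "\<beta> ` {f..e} \<subseteq> N"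
      by (rule geodesic_side_in_piece[OF \<alpha>(1) \<beta>(1) \<gamma>(1) ends(1,2) _ _ r(1)])
         (use \<beta>(2,3) ends r z\<alpha> \<gamma>(2) in auto)
    have e01: "e \<in> {0..1}" using feN by auto
    have "dist z p > 0" using z by (simp add: p_def)
    then have Lpos: "dist (\<gamma> 0) p > 0" using L zero_le_dist[of "\<gamma> 0" z] by linarith
    then have "\<beta> 0 \<noteq> \<beta> 1" using \<beta> by auto
    then have "\<beta> e \<noteq> z" using geodesic_path_inj[OF \<beta>(1) _ e01 r(1)] r feN by simp
    moreover have "\<beta> e \<in> path_image b"
    proof (rule ccontr)
      assume "\<beta> e \<notin> path_image b"
      then have "\<beta> e \<in> path_image a" using \<beta>(4) e01 unfolding path_image_def by blast
      from geodesic_path_dist_le[OF a(1) this] have "dist (\<gamma> 0) (\<beta> e) \<le> dist (\<gamma> 0) z" unfolding a .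
      moreover have "dist (\<gamma> 0) (\<beta> e) = dist (\<gamma> 0) p * e" "dist (\<gamma> 0) z = dist (\<gamma> 0) p * r"
        using geodesic_path_dist_0[OF \<beta>(1) e01] geodesic_path_dist_0[OF \<beta>(1) r(1)] \<beta> r by simp_all
      moreover have "dist (\<gamma> 0) p * r < dist (\<gamma> 0) p * e" using Lpos feN(3) by simp
      ultimately show False by linarith
    qed
    then obtain s where "s \<in> {0..1}" "\<beta> e = h s" using b(4) unfolding path_image_def by blast
    moreover have "\<beta> e \<in> N" "z \<in> N" using feN r by auto
    ultimately show False using isolated[OF feN(5), of s] by metis
  qed
  have "through (h 0) = through (h 1)"
  proof (rule connected_local_const[of "path_image c"], rule connected_path_image[OF c(1)])
    show "h 0 \<in> path_image c" "h 1 \<in> path_image c"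
      using pathstart_in_path_image[of c] pathfinish_in_path_image[of c] c
      by (simp_all add: pathstart_def pathfinish_def)
    show "\<forall>w\<in>path_image c. eventually (\<lambda>w'. through w = through w') (at w within path_image c)"
    proof
      fix w assume "w \<in> path_image c"
      then have "0 < dist w z" using zc by auto
      moreover have "through w = through w'" if w': "dist w' w < dist w z" for w'
      proof -
        obtain \<gamma> where \<gamma>: "geodesic_path \<gamma>" "\<gamma> 0 = w" "\<gamma> 1 = w'" by (rule obtain_geodesic)
        have z\<gamma>: "z \<notin> path_image \<gamma>"
        proof
          assume "z \<in> path_image \<gamma>"
          from geodesic_path_dist_le[OF \<gamma>(1) this] show False
            unfolding \<gamma>(2,3) using w' by (simp add: dist_commute)
        qed
        have 01: "1 \<in> {0..1::real}" "0 \<in> {0..1::real}" by auto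
        have "z \<notin> path_image (subarc 1 0 \<gamma>)" using path_image_subarc_subset[OF 01] z\<gamma> by blast
        then show ?thesis
          using step[OF \<gamma>(1) z\<gamma>] step[OF geodesic_path_subarc[OF \<gamma>(1) 01]] \<gamma> by auto
      qed
      ultimately show "eventually (\<lambda>w'. through w = through w') (at w within path_image c)"
        unfolding eventually_at by blast
    qed
  qed
  moreover have "through (h 0)"
  proof -
    have "z \<in> path_image h" using t z(1) by (auto simp: path_image_def)
    from geodesic_path_dist_sum[OF h this] show ?thesis by (simp add: through_def p_def)
  qed
  moreover have "\<not> through (h 1)" using z by (simp add: through_def p_def dist_commute)
  ultimately show False by simp
qed

text \<open>As \<open>c\<close> avoids \<open>h t\<close>, this is not a cut point, and some piece \<open>N\<close> contains \<open>h t\<close> and another point of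
  \<open>h\<close>. The ends of \<open>h\<close> then have different gates in \<open>N\<close>, since a common gate would be a shortcut past a
  segment of \<open>h\<close>. Hence \<open>c\<close> must meet \<open>N\<close>, and it contains both gates.\<close>
lemma path_meets_piece_twice:
  assumes h: "geodesic_path h" and t: "t \<in> {0..1}" and c: "path c" "c 0 = h 0" "c 1 = h 1"
    and out: "h t \<notin> path_image c"
  obtains N x y where "N \<in> \<P>" "x \<in> N" "y \<in> N" "x \<in> path_image c" "y \<in> path_image c" "x \<noteq> y"
proof -
  have "h t \<noteq> h 1"
    using out pathfinish_in_path_image[of c] c(3) unfolding pathfinish_def by metis
  then obtain N s where N: "N \<in> \<P>" "h t \<in> N" "h s \<in> N" "s \<in> {0..1}" "h s \<noteq> h t"
    using geodesic_cut_point[OF h t refl _ _ c] out by blast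
  obtain y where y: "is_gate N (h 0) y" using gate_exists[OF N(1,2)] .
  obtain y' where y': "is_gate N (h 1) y'" using gate_exists[OF N(1,2)] .
  define l where "l = dist (h 0) (h 1)"
  have "s \<noteq> t" using N(5) by auto
  have "h 0 \<noteq> h 1"
  proof
    assume "h 0 = h 1"
    then have "h s \<in> {h 0}" "h t \<in> {h 0}"
      using path_image_const_geodesic[OF h] N(4) t unfolding path_image_def by blast+
    then show False using N(5) by simp
  qed
  then have "l > 0" by (simp add: l_def)
  have near: "dist (h 0) y \<le> l * r" "dist (h 1) y' \<le> l * (1 - r)" if "r \<in> {0..1}" "h r \<in> N" for r
  proof -
    have "dist (h 0) (h r) = dist (h 0) y + dist y (h r)" "dist (h 1) (h r) = dist (h 1) y' + dist y' (h r)"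
      using is_gate_dist[OF y that(2)] is_gate_dist[OF y' that(2)] .
    moreover have "dist (h 0) (h r) = l * r" "dist (h 1) (h r) = l * (1 - r)"
      using geodesic_path_dist_0[OF h that(1)] geodesic_path_dist_1[OF h that(1)]
      by (simp_all add: l_def dist_commute)
    ultimately show "dist (h 0) y \<le> l * r" "dist (h 1) y' \<le> l * (1 - r)"
      using zero_le_dist[of y "h r"] zero_le_dist[of y' "h r"] by linarith+
  qed
  have "y \<noteq> y'"
  proof
    assume "y = y'"
    then have tri: "l \<le> dist (h 0) y + dist (h 1) y'"
      using dist_triangle[of "h 0" "h 1" y] by (simp add: l_def dist_commute)
    have "l * s < l * t \<or> l * t < l * s" using \<open>l > 0\<close> \<open>s \<noteq> t\<close> by auto
    then show False
      using tri near[OF N(4,3)] near[OF t N(2)] by (auto simp: algebra_simps)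
  qed
  have "path_image c \<inter> N \<noteq> {}"
  proof
    assume "path_image c \<inter> N = {}"
    moreover have "h 0 \<in> path_image c" "h 1 \<in> path_image c"
      using pathstart_in_path_image[of c] pathfinish_in_path_image[of c] c
      by (simp_all add: pathstart_def pathfinish_def)
    ultimately show False
      using gate_eq_on_connected[OF N(1) connected_path_image[OF c(1)]] y y' \<open>y \<noteq> y'\<close> by blast
  qed
  then obtain r where r: "r \<in> {0..1}" "c r \<in> N" unfolding path_image_def by blast
  have 01: "1 \<in> {0..1::real}" "0 \<in> {0..1::real}" by auto
  have "y \<in> path_image (subarc 0 r c)"
    by (rule gate_in_path_image[OF N(1) path_subarc[OF c(1) 01(2) r(1)]]) (use c y r in auto)
  moreover have "y' \<in> path_image (subarc 1 r c)"
    by (rule gate_in_path_image[OF N(1) path_subarc[OF c(1) 01(1) r(1)]]) (use c y' r in auto)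
  ultimately have "y \<in> path_image c" "y' \<in> path_image c"
    using path_image_subarc_subset[OF 01(2) r(1), of c] path_image_subarc_subset[OF 01(1) r(1), of c] by blast+
  then show thesis
    using that[OF N(1) is_gate_mem[OF y] is_gate_mem[OF y']] \<open>y \<noteq> y'\<close> by blast
qed

text \<open>Split the loop into two arcs with the same endpoints. The midpoint of a geodesic between these endpoints
  is missed by at least one of the arcs; this arc meets some piece twice, and that piece contains
  the loop.\<close>
lemma simple_loop_in_one_piece:
  assumes g: "simple_loop g"
  shows "in_one_piece \<P> (path_image g)"
proof -
  have "g 0 \<noteq> g (1/2)"
    using g unfolding simple_loop_def simple_path_def loop_free_def by fastforce
  moreover have "g 0 \<in> path_image g" "g (1/2) \<in> path_image g" by (auto simp: path_image_def)
  ultimately obtain c d where cd: "arc c" "arc d" "pathstart c = g 0" "pathfinish c = g (1/2)"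
    "pathstart d = g (1/2)" "pathfinish d = g 0"
    "path_image c \<inter> path_image d = {g 0, g (1/2)}" "path_image c \<union> path_image d = path_image g"
    using simple_loop_double_arc[OF g] by metis
  obtain h where h: "geodesic_path h" "h 0 = g 0" "h 1 = g (1/2)" by (rule obtain_geodesic)
  have half: "1/2 \<in> {0..1::real}" by simp
  have "h (1/2) \<notin> path_image c \<inter> path_image d"
    using geodesic_path_inj[OF h(1), of "1/2" 0] geodesic_path_inj[OF h(1), of "1/2" 1] h \<open>g 0 \<noteq> g (1/2)\<close>
    unfolding cd(7) by auto
  then obtain k where k: "path k" "k 0 = h 0" "k 1 = h 1" "h (1/2) \<notin> path_image k" "path_image k \<subseteq> path_image g"
  proof (cases "h (1/2) \<in> path_image c")
    case False
    then show ?thesis using that[of c] cd h by (auto simp: arc_def pathstart_def pathfinish_def)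
  next
    case True
    then have "h (1/2) \<notin> path_image d" using \<open>h (1/2) \<notin> path_image c \<inter> path_image d\<close> by blast
    moreover have "reversepath d 0 = h 0" "reversepath d 1 = h 1"
      using cd h by (simp_all add: reversepath_def pathstart_def pathfinish_def)
    moreover have "path (reversepath d)" using cd(2) by (simp add: arc_def)
    moreover have "path_image (reversepath d) = path_image d" by simp
    ultimately show ?thesis using that[of "reversepath d"] cd(8) by blast
  qed
  obtain N x y where "N \<in> \<P>" "x \<in> N" "y \<in> N" "x \<in> path_image k" "y \<in> path_image k" "x \<noteq> y"
    using path_meets_piece_twice[OF h(1) half k(1-4)] .
  then have "path_image g \<subseteq> N" using loop_in_piece[OF _ g] k(5) by blast
  then show ?thesis using \<open>N \<in> \<P>\<close> unfolding in_one_piece_def by blast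
qed

end

section \<open>The three conditions\<close>

lemma T2_imp_cover:
  assumes "cond_T2 \<P>"
  shows "\<Union>\<P> = UNIV"
proof -
  have "\<exists>P\<in>\<P>. x \<in> P" for x
  proof -
    have "simple_geodesic_triangle {x}" unfolding simple_geodesic_triangle_def by blast
    then show ?thesis using assms unfolding cond_T2_def in_one_piece_def by blast
  qed
  then show ?thesis by blast
qed

lemma T2''_imp_T2:
  fixes \<P> :: "'a::metric_space set set"
  assumes cover: "\<Union>\<P> = UNIV" and T2'': "cond_T2'' \<P>"
  shows "cond_T2 \<P>"
  unfolding cond_T2_def
proof (intro allI impI)
  fix T :: "'a set" assume "simple_geodesic_triangle T"
  then consider x where "T = {x}" | g where "simple_loop g" "T = path_image g"
    unfolding simple_geodesic_triangle_def by metis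
  then show "in_one_piece \<P> T"
  proof cases
    case (1 x)
    obtain P where "P \<in> \<P>" "x \<in> P" using cover by (metis UNIV_I UnionE)
    then show ?thesis unfolding in_one_piece_def 1 by blast
  next
    case (2 g)
    then show ?thesis using T2'' unfolding cond_T2''_def by blast
  qed
qed

text \<open>A stretch of \<open>c\<close> between two consecutive encounters with \<open>c'\<close> forms a simple loop with the
  part of \<open>c'\<close> between these encounters.\<close>
lemma T2''_detour_in_one_piece:
  fixes c c' :: "real \<Rightarrow> 'a::t2_space"
  assumes T2'': "cond_T2'' \<P>" and c: "arc c" and c': "arc c'"
    and ends: "pathstart c' = pathstart c" "pathfinish c' = pathfinish c"
    and r: "r \<in> {0..1}" "c r \<notin> path_image c'"
  obtains a b where "0 \<le> a" "a < r" "r < b" "b \<le> 1" "in_one_piece \<P> (c ` {a..b})"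
proof -
  have pc: "path c" "inj_on c {0..1}" using c by (auto simp: arc_def)
  have pc': "path c'" using c' by (simp add: arc_def)
  have cont: "continuous_on {0..1} c" using pc by (simp add: path_def)
  have closed: "closed (path_image c')" by (intro compact_imp_closed compact_path_image pc')
  have c01: "c 0 \<in> path_image c'" "c 1 \<in> path_image c'"
    using ends pathstart_in_path_image[of c'] pathfinish_in_path_image[of c']
    by (simp_all add: pathstart_def pathfinish_def)
  obtain b where b: "r \<le> b" "b \<le> 1" "c b \<in> path_image c'"
    "\<And>x. r \<le> x \<Longrightarrow> x < b \<Longrightarrow> c x \<notin> path_image c'"
  proof (rule first_hit[of r 1 c "path_image c'"])
    show "continuous_on {r..1} c" by (rule continuous_on_subset[OF cont]) (use r in auto)
  qed (use closed c01 r in auto)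
  obtain a where a: "0 \<le> a" "a \<le> r" "c a \<in> path_image c'"
    "\<And>x. a < x \<Longrightarrow> x \<le> r \<Longrightarrow> c x \<notin> path_image c'"
  proof (rule last_hit[of 0 r c "path_image c'"])
    show "continuous_on {0..r} c" by (rule continuous_on_subset[OF cont]) (use r in auto)
  qed (use closed c01 r in auto)
  have arb: "a < r" "r < b" using a(2,3) b(1,3) r(2) by (auto simp: less_le)
  have ab01: "a \<in> {0..1}" "b \<in> {0..1}" "a \<noteq> b" using a b arb by auto
  have inner: "x = a \<or> x = b" if "x \<in> {a..b}" "c x \<in> path_image c'" for x
    using a(4)[of x] b(4)[of x] that by fastforce
  obtain a' b' where a'b': "a' \<in> {0..1}" "b' \<in> {0..1}" "c' a' = c a" "c' b' = c b"
    using a(3) b(3) unfolding path_image_def by (metis imageE)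
  have "c a \<noteq> c b" using inj_onD[OF pc(2), of a b] ab01 by auto
  then have "b' \<noteq> a'" using a'b' by auto
  define k where "k = subarc a b c"
  define k' where "k' = subarc b' a' c'"
  have arcs: "arc k" "arc k'"
    unfolding k_def k'_def
    by (rule arc_subarc_arc[OF c ab01], rule arc_subarc_arc[OF c' a'b'(2,1) \<open>b' \<noteq> a'\<close>])
  have k_image: "path_image k = c ` {a..b}" unfolding k_def using arb by (simp add: path_image_subarc_le)
  have k'_image: "path_image k' \<subseteq> path_image c'"
    unfolding k'_def by (rule path_image_subarc_subset[OF a'b'(2,1)])
  have join: "pathfinish k = pathstart k'" "pathfinish k' = pathstart k"
    unfolding k_def k'_def using a'b' by simp_all
  have "path_image k \<inter> path_image k' \<subseteq> {pathstart k, pathstart k'}"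
  proof
    fix y assume y: "y \<in> path_image k \<inter> path_image k'"
    then obtain x where "x \<in> {a..b}" "y = c x" unfolding k_image by blast
    moreover have "y \<in> path_image c'" using y k'_image by blast
    ultimately have "y \<in> {c a, c b}" using inner[of x] by auto
    then show "y \<in> {pathstart k, pathstart k'}" unfolding k_def k'_def using a'b'(4) by simp
  qed
  then have "simple_path (k +++ k')" using simple_path_join_loop[OF arcs join] by blast
  then have "simple_loop (k +++ k')" using join by (simp add: simple_loop_def)
  then have "in_one_piece \<P> (path_image (k +++ k'))" using T2'' unfolding cond_T2''_def by blast
  then have "in_one_piece \<P> (c ` {a..b})"
    unfolding in_one_piece_def path_image_join[OF join(1)] k_image by blast
  then show thesis using that a(1) b(2) arb by blast
qed

text \<open>If \<open>c'\<close> missed an end \<open>c r\<close> of a maximal sub-arc \<open>c ` {s..u}\<close>, a detour around \<open>c r\<close> would lie in a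
  piece. When \<open>s < u\<close>, this piece and that of the maximal sub-arc have an overlap of more than one point and
  coincide by (T1); when \<open>s = u\<close>, the detour itself contains the sub-arc. Either way the maximal sub-arc
  could be extended beyond \<open>c r\<close>.\<close>
lemma T2''_imp_T2':
  fixes \<P> :: "'a::t2_space set set"
  assumes T1: "cond_T1 \<P>" and T2'': "cond_T2'' \<P>"
  shows "cond_T2' \<P>"
  unfolding cond_T2'_def
proof (intro allI impI)
  fix c t s u and c' :: "real \<Rightarrow> 'a"
  assume "arc c \<and> t \<in> {0..1} \<and> maximal_subarc_in_piece \<P> c t s u"
  then have c: "arc c" and su: "0 \<le> s" "s \<le> u" "u \<le> 1" and "in_one_piece \<P> (c ` {s..u})"
    and maximal: "\<And>s' u'. 0 \<le> s' \<Longrightarrow> s' \<le> s \<Longrightarrow> u \<le> u' \<Longrightarrow> u' \<le> 1 \<Longrightarrow>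
      in_one_piece \<P> (c ` {s'..u'}) \<Longrightarrow> s' = s \<and> u' = u"
    unfolding maximal_subarc_in_piece_def by auto
  then obtain M where M: "M \<in> \<P>" "c ` {s..u} \<subseteq> M" unfolding in_one_piece_def by blast
  assume "arc c' \<and> pathstart c' = pathstart c \<and> pathfinish c' = pathfinish c"
  then have c': "arc c'" "pathstart c' = pathstart c" "pathfinish c' = pathfinish c" by auto
  have on_c': "c r \<in> path_image c'" if r: "r = s \<or> r = u" for r
  proof (rule ccontr)
    assume out: "c r \<notin> path_image c'"
    have r01: "r \<in> {0..1}" using r su by auto
    obtain a b where ab: "0 \<le> a" "a < r" "r < b" "b \<le> 1" "in_one_piece \<P> (c ` {a..b})"
      by (rule T2''_detour_in_one_piece[OF T2'' c c' r01 out])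
    then obtain N where N: "N \<in> \<P>" "c ` {a..b} \<subseteq> N" unfolding in_one_piece_def by blast
    have "in_one_piece \<P> (c ` {min a s..max b u})"
    proof (cases "s = u")
      case True
      then have "min a s = a" "max b u = b" using ab r by auto
      then show ?thesis using ab(5) by simp
    next
      case False
      define x y where "x = max a s" and "y = min b u"
      have xy: "x \<in> {s..u}" "x \<in> {a..b}" "y \<in> {s..u}" "y \<in> {a..b}" "x \<noteq> y"
        using False su ab r by (auto simp: x_def y_def)
      have "inj_on c {0..1}" using c by (simp add: arc_def)
      then have "c x \<noteq> c y" using inj_onD[of c "{0..1}" x y] xy su by auto
      moreover have "c x \<in> M \<inter> N" "c y \<in> M \<inter> N" using xy M(2) N(2) by blast+
      ultimately have "M = N" using T1 M(1) N(1) unfolding cond_T1_def by blast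
      moreover have "{min a s..max b u} \<subseteq> {a..b} \<union> {s..u}" using ab r by auto
      ultimately have "c ` {min a s..max b u} \<subseteq> M" using M(2) N(2) by blast
      then show ?thesis using M(1) unfolding in_one_piece_def by blast
    qed
    then have "min a s = s \<and> max b u = u" using maximal[of "min a s" "max b u"] ab su by auto
    then show False using ab r by auto
  qed
  show "c s \<in> path_image c' \<and> c u \<in> path_image c'" using on_c' by blast
qed

text \<open>If some nondegenerate sub-arc through \<open>c t\<close> lies in a piece \<open>M\<close>, a larger sub-arc in any piece is still
  in \<open>M\<close> by (T1). It then suffices to take the component of \<open>t\<close> in the set of parameters at which \<open>c\<close> is in \<open>M\<close>,
  which is a closed interval because \<open>M\<close> is closed. Otherwise the point \<open>c t\<close> alone is maximal; here the
  pieces must cover \<open>c t\<close>.\<close>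
lemma maximal_subarc_in_piece_exists:
  fixes c :: "real \<Rightarrow> 'a::t2_space"
  assumes cover: "\<Union>\<P> = UNIV" and closed: "\<forall>P\<in>\<P>. closed P" and T1: "cond_T1 \<P>"
    and c: "arc c" and t: "t \<in> {0..1}"
  obtains s u where "maximal_subarc_in_piece \<P> c t s u"
proof (cases "\<exists>s u. 0 \<le> s \<and> s \<le> t \<and> t \<le> u \<and> u \<le> 1 \<and> s < u \<and> in_one_piece \<P> (c ` {s..u})")
  case True
  then obtain s u M where su: "0 \<le> s" "s \<le> t" "t \<le> u" "u \<le> 1" "s < u" and M: "M \<in> \<P>" "c ` {s..u} \<subseteq> M"
    unfolding in_one_piece_def by blast
  have cont: "continuous_on {0..1} c" and inj: "inj_on c {0..1}" using c by (auto simp: arc_def path_def)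
  define K where "K = {0..1} \<inter> c -` M"
  define C where "C = connected_component_set K t"
  have "closed K"
    unfolding K_def by (rule continuous_closed_preimage[OF cont closed_atLeastAtMost closed[rule_format, OF M(1)]])
  have C_sub: "C \<subseteq> K" unfolding C_def by (rule connected_component_subset)
  have in_C: "{a..b} \<subseteq> C" if "a \<le> t" "t \<le> b" "0 \<le> a" "b \<le> 1" "c ` {a..b} \<subseteq> M" for a b
    unfolding C_def by (rule connected_component_maximal) (use that in \<open>auto simp: K_def\<close>)
  have "closed C" unfolding C_def by (rule closed_connected_component[OF \<open>closed K\<close>])
  moreover have "bounded C" by (rule bounded_subset[of "{0..1}"]) (use C_sub K_def in auto)
  ultimately have "compact C" by (simp add: compact_eq_bounded_closed)
  moreover have "connected C" unfolding C_def by simp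
  ultimately obtain a b where ab: "C = {a..b}" using connected_compact_interval_1 by metis
  have "{s..u} \<subseteq> C" using in_C[of s u] su M(2) by blast
  then have asub: "a \<le> s" "u \<le> b" using su(5) unfolding ab by auto
  have "{a..b} \<subseteq> K" using C_sub ab by simp
  then have ab01: "0 \<le> a" "b \<le> 1" and abM: "c ` {a..b} \<subseteq> M"
    using asub su(5) by (auto simp: K_def)
  have "maximal_subarc_in_piece \<P> c t a b"
    unfolding maximal_subarc_in_piece_def
  proof (intro conjI allI impI)
    show "in_one_piece \<P> (c ` {a..b})" using abM M(1) unfolding in_one_piece_def by blast
    fix a' b' assume *: "0 \<le> a' \<and> a' \<le> a \<and> b \<le> b' \<and> b' \<le> 1 \<and> in_one_piece \<P> (c ` {a'..b'})"
    then obtain N where N: "N \<in> \<P>" "c ` {a'..b'} \<subseteq> N" unfolding in_one_piece_def by blast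
    have "c s \<noteq> c u" using inj_onD[OF inj, of s u] su by auto
    moreover have "c s \<in> M \<inter> N" "c u \<in> M \<inter> N" using M(2) N(2) su asub * by auto
    ultimately have "N = M" using T1 M(1) N(1) unfolding cond_T1_def by blast
    then have "{a'..b'} \<subseteq> {a..b}" using in_C[of a' b'] N(2) su asub * unfolding ab by auto
    then show "a' = a" "b' = b" using su asub * by auto
  qed (use ab01 asub su in auto)
  then show ?thesis by (rule that)
next
  case False
  obtain P where "P \<in> \<P>" "c t \<in> P" using cover by (metis UNIV_I UnionE)
  then have "in_one_piece \<P> (c ` {t..t})" unfolding in_one_piece_def by (auto intro: bexI[of _ P])
  moreover have "s' = t \<and> u' = t"
    if "0 \<le> s' \<and> s' \<le> t \<and> t \<le> u' \<and> u' \<le> 1 \<and> in_one_piece \<P> (c ` {s'..u'})" for s' u'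
  proof -
    have "\<not> s' < u'" using False that by blast
    then show ?thesis using that by linarith
  qed
  ultimately have "maximal_subarc_in_piece \<P> c t t t"
    unfolding maximal_subarc_in_piece_def using t by (intro conjI allI impI) (simp_all, blast+)
  then show ?thesis by (rule that)
qed

text \<open>By \<open>(T\<^sub>2')\<close> the ends of a maximal sub-arc around the midpoint of \<open>c\<close> lie on \<open>c'\<close>, which \<open>c\<close> meets only in
  its endpoints. So the maximal sub-arc is all of \<open>c\<close>.\<close>
lemma T2'_arc_in_one_piece:
  fixes c c' :: "real \<Rightarrow> 'a::t2_space"
  assumes cover: "\<Union>\<P> = UNIV" and closed: "\<forall>P\<in>\<P>. closed P" and T1: "cond_T1 \<P>"
    and T2': "cond_T2' \<P>" and c: "arc c" and c': "arc c'"
    and ends: "pathstart c' = pathstart c" "pathfinish c' = pathfinish c"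
    and disjoint: "path_image c \<inter> path_image c' \<subseteq> {pathstart c, pathfinish c}"
  shows "in_one_piece \<P> (path_image c)"
proof -
  have half: "1/2 \<in> {0..1::real}" by simp
  obtain s u where max: "maximal_subarc_in_piece \<P> c (1/2) s u"
    using maximal_subarc_in_piece_exists[OF cover closed T1 c half] .
  then have su: "0 \<le> s" "s \<le> 1/2" "1/2 \<le> u" "u \<le> 1" "in_one_piece \<P> (c ` {s..u})"
    unfolding maximal_subarc_in_piece_def by auto
  have su01: "s \<in> {0..1}" "u \<in> {0..1}" using su by auto
  have "c s \<in> path_image c'" "c u \<in> path_image c'"
    using T2' c half max c' ends unfolding cond_T2'_def by blast+
  moreover have "c s \<in> path_image c" "c u \<in> path_image c" using su01 by (auto simp: path_image_def)
  ultimately have "c s \<in> {c 0, c 1}" "c u \<in> {c 0, c 1}"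
    using disjoint by (auto simp: pathstart_def pathfinish_def)
  moreover have "x = y" if "c x = c y" "x \<in> {0..1}" "y \<in> {0..1}" for x y
    using c that by (auto simp: arc_def inj_on_def)
  ultimately have "s \<in> {0, 1}" "u \<in> {0, 1}" using su01 by auto
  then have "s = 0" "u = 1" using su by auto
  then show ?thesis using su(5) by (simp add: path_image_def)
qed

text \<open>Each of two complementary arcs of the loop lies in a piece, and both pieces contain the two common
  endpoints of the arcs, so they coincide by (T1).\<close>
lemma T2'_imp_T2'':
  fixes \<P> :: "'a::t2_space set set"
  assumes cover: "\<Union>\<P> = UNIV" and closed: "\<forall>P\<in>\<P>. closed P" and T1: "cond_T1 \<P>"
    and T2': "cond_T2' \<P>"
  shows "cond_T2'' \<P>"
  unfolding cond_T2''_def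
proof (intro allI impI)
  fix g :: "real \<Rightarrow> 'a" assume g: "simple_loop g"
  have ne: "g 0 \<noteq> g (1/2)"
    using g unfolding simple_loop_def simple_path_def loop_free_def by fastforce
  have "g 0 \<in> path_image g" "g (1/2) \<in> path_image g" by (auto simp: path_image_def)
  then obtain c d where cd: "arc c" "arc d" "pathstart c = g 0" "pathfinish c = g (1/2)"
    "pathstart d = g (1/2)" "pathfinish d = g 0"
    "path_image c \<inter> path_image d = {g 0, g (1/2)}" "path_image c \<union> path_image d = path_image g"
    using simple_loop_double_arc[OF g _ _ ne] by metis
  have d': "arc (reversepath d)" using cd(2) by (rule arc_reversepath)
  have "in_one_piece \<P> (path_image c)"
    by (rule T2'_arc_in_one_piece[OF cover closed T1 T2' cd(1) d']) (use cd in auto)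
  then obtain M where M: "M \<in> \<P>" "path_image c \<subseteq> M" unfolding in_one_piece_def by blast
  have "in_one_piece \<P> (path_image (reversepath d))"
    by (rule T2'_arc_in_one_piece[OF cover closed T1 T2' d' cd(1)]) (use cd in auto)
  then obtain N where N: "N \<in> \<P>" "path_image d \<subseteq> N" unfolding in_one_piece_def by auto
  have "g 0 \<in> M \<inter> N" "g (1/2) \<in> M \<inter> N" using cd(7) M(2) N(2) by blast+
  then have "M = N" using T1 M(1) N(1) ne unfolding cond_T1_def by blast
  then have "path_image g \<subseteq> M" using cd(8) M(2) N(2) by blast
  then show "in_one_piece \<P> (path_image g)" using M(1) unfolding in_one_piece_def by blast
qed

theorem proposition2p17:
  fixes \<P> :: "'a::complete_space set set"
  assumes geodesic_space: "geodesic_subset (UNIV :: 'a set)"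
    and pieces: "\<And>P. P \<in> \<P> \<Longrightarrow> closed P \<and> geodesic_subset P"
    and T1: "cond_T1 \<P>"
  shows "(cond_T2 \<P> \<longleftrightarrow> (\<Union>\<P> = UNIV \<and> cond_T2' \<P>)) \<and>
    ((\<Union>\<P> = UNIV \<and> cond_T2' \<P>) \<longleftrightarrow> (\<Union>\<P> = UNIV \<and> cond_T2'' \<P>)) \<and>
    (cond_T2 \<P> \<longleftrightarrow> (\<Union>\<P> = UNIV \<and> cond_T2'' \<P>)) \<and>
    (tree_graded \<P> \<longleftrightarrow> (\<Union>\<P> = UNIV \<and> cond_T2' \<P>)) \<and>
    (tree_graded \<P> \<longleftrightarrow> (\<Union>\<P> = UNIV \<and> cond_T2'' \<P>))"
proof -
  have T2_T2'': "cond_T2'' \<P>" if "cond_T2 \<P>"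
  proof -
    have "tree_graded_pieces \<P>"
      by (rule tree_graded_pieces.intro) (use geodesic_space pieces T1 that in simp_all)
    then show ?thesis
      unfolding cond_T2''_def by (simp add: tree_graded_pieces.simple_loop_in_one_piece)
  qed
  have c: "cond_T2 \<P> \<longleftrightarrow> (\<Union>\<P> = UNIV \<and> cond_T2'' \<P>)"
    using T2_T2'' T2_imp_cover[of \<P>] T2''_imp_T2[of \<P>] by argo
  have closed: "\<forall>P\<in>\<P>. closed P" using pieces by simp
  have b: "(\<Union>\<P> = UNIV \<and> cond_T2' \<P>) \<longleftrightarrow> (\<Union>\<P> = UNIV \<and> cond_T2'' \<P>)"
    using T2''_imp_T2'[OF T1] T2'_imp_T2''[OF _ closed T1] by argo
  have "tree_graded \<P> \<longleftrightarrow> cond_T2 \<P>"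
    unfolding tree_graded_def using geodesic_space pieces T1 by simp
  with b c show ?thesis by simp
qed

end
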